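(* Consider the linear-in-means model on a network with $n$ nodes, $Y=\alpha 1_n+\beta GY+\gamma T+\delta GT+\varepsilon$, and suppose that $\varepsilon\sim\mathcal N(0,\sigma_\varepsilon^2 I)$ and that the entries of $T\in\mathbb R^n$ are drawn i.i.d. according to a distribution with mean $\tau\in\mathbb R$. Let $\Theta=\{(\alpha,\beta,\gamma,\delta):\alpha,\gamma,\delta\in\mathbb R,\ \beta\in(-1,1)\}$. Then there exist $N$ and positive constants $c_\beta,c_\delta,c_0$, not depending on $n$, such that for all $n>N$, $$\inf_{\hat\theta}\ \sup_{\theta\in\Theta}\ \min\left\{P_\theta\!\left[|\hat\beta-\beta|\ge\frac{c_\beta}{\|G\|_F}\right],\ P_\theta\!\left[|\hat\delta-\delta|\ge\frac{c_\delta}{\|G\|_F}\right]\right\}\ge c_0,$$ where the infimum is over all estimators $\hat\theta=(\hat\alpha,\hat\beta,\hat\gamma,\hat\delta)$ of $\theta=(\alpha,\beta,\gamma,\delta)$. Further, if $\tau\neq 0$, there exist positive constants $c_\alpha$ and $c_\alpha'$, not depending on $n$, such that for all $n>N$, $$\inf_{\hat\theta}\ \sup_{\theta\in\Theta}\ P_\theta\!\left[|\hat\alpha-\alpha|\ge\frac{c_\alpha}{\|G\|_F}\right]\ge c_\alpha'.$$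
   Context: The network is encoded by a symmetric adjacency matrix $A\in\mathbb R^{n\times n}$ with non-negative entries; $d_i=\sum_j A_{ij}$ is the degree of node $i$, $D=\mathrm{diag}(d_1,\dots,d_n)$, and $G=D^{-1}A$ is the row-normalized adjacency matrix (degrees are positive so that $G$ is defined). $Y\in\mathbb R^n$ is the vector of nodal outcomes, $T\in\mathbb R^n$ the vector of nodal covariates (treatments), $1_n$ the all-ones vector, and $\|\cdot\|_F$ the Frobenius norm. The errors $\varepsilon$ are independent of the network $A$ and of $T$. Since $|\beta|<1$, $I-\beta G$ is invertible and $Y=(I-\beta G)^{-1}(\alpha 1_n+\gamma T+\delta GT+\varepsilon)$. $P_\theta$ denotes probability when the data are generated from this model with parameter $\theta$. *)

theory Defs
  imports "HOL-Probability.Probability"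
begin

text \<open>The number of nodes varies inside the result, so nodes are the naturals below \<open>n\<close>,
  \<open>n \<times> n\<close> matrices are functions \<open>nat \<Rightarrow> nat \<Rightarrow> real\<close> read on indices below \<open>n\<close>, and vectors are
  functions that are \<^const>\<open>undefined\<close> from \<open>n\<close> on, as in the space of a product measure.\<close>

definition degree :: "nat \<Rightarrow> (nat \<Rightarrow> nat \<Rightarrow> real) \<Rightarrow> nat \<Rightarrow> real" where
  "degree n A i = (\<Sum>j<n. A i j)"

definition network :: "nat \<Rightarrow> (nat \<Rightarrow> nat \<Rightarrow> real) \<Rightarrow> bool" where
  "network n A \<longleftrightarrow>
     (\<forall>i<n. \<forall>j<n. 0 \<le> A i j \<and> A i j = A j i) \<and> (\<forall>i<n. 0 < degree n A i)"

definition row_normalized :: "nat \<Rightarrow> (nat \<Rightarrow> nat \<Rightarrow> real) \<Rightarrow> nat \<Rightarrow> nat \<Rightarrow> real" where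
  "row_normalized n A i j = A i j / degree n A i"

definition frobenius :: "nat \<Rightarrow> (nat \<Rightarrow> nat \<Rightarrow> real) \<Rightarrow> real" where
  "frobenius n M = sqrt (\<Sum>i<n. \<Sum>j<n. (M i j)\<^sup>2)"

definition mat_vec :: "nat \<Rightarrow> (nat \<Rightarrow> nat \<Rightarrow> real) \<Rightarrow> (nat \<Rightarrow> real) \<Rightarrow> nat \<Rightarrow> real" where
  "mat_vec n M x i = (\<Sum>j<n. M i j * x j)"

text \<open>A parameter is \<open>\<theta> = (\<alpha>, \<beta>, \<gamma>, \<delta>)\<close>.\<close>

type_synonym param = "real \<times> real \<times> real \<times> real"

definition alpha_of :: "param \<Rightarrow> real" where "alpha_of \<theta> = fst \<theta>"
definition beta_of :: "param \<Rightarrow> real" where "beta_of \<theta> = fst (snd \<theta>)"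
definition gamma_of :: "param \<Rightarrow> real" where "gamma_of \<theta> = fst (snd (snd \<theta>))"
definition delta_of :: "param \<Rightarrow> real" where "delta_of \<theta> = snd (snd (snd \<theta>))"

definition param_space :: "param set" where
  "param_space = {\<theta>. -1 < beta_of \<theta> \<and> beta_of \<theta> < 1}"

definition is_outcome ::
  "nat \<Rightarrow> (nat \<Rightarrow> nat \<Rightarrow> real) \<Rightarrow> param \<Rightarrow> (nat \<Rightarrow> real) \<Rightarrow> (nat \<Rightarrow> real) \<Rightarrow> (nat \<Rightarrow> real) \<Rightarrow> bool" where
  "is_outcome n A \<theta> T e Y \<longleftrightarrow> Y \<in> extensional {..<n} \<and>
     (let G = row_normalized n A in
      \<forall>i<n. Y i = alpha_of \<theta> + beta_of \<theta> * mat_vec n G Y i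
                + gamma_of \<theta> * T i + delta_of \<theta> * mat_vec n G T i + e i)"

text \<open>For a network and \<open>\<bar>\<beta>\<bar> < 1\<close> the solution exists and is unique
  (\<open>ex1_is_outcome\<close> below), so it is
  \<open>(I - \<beta>G)\<^sup>-\<^sup>1 (\<alpha>1 + \<gamma>T + \<delta>GT + e)\<close>.\<close>

definition outcome ::
  "nat \<Rightarrow> (nat \<Rightarrow> nat \<Rightarrow> real) \<Rightarrow> param \<Rightarrow> (nat \<Rightarrow> real) \<Rightarrow> (nat \<Rightarrow> real) \<Rightarrow> nat \<Rightarrow> real" where
  "outcome n A \<theta> T e = (THE Y. is_outcome n A \<theta> T e Y)"

definition data_space :: "nat \<Rightarrow> ((nat \<Rightarrow> real) \<times> (nat \<Rightarrow> real)) measure" where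
  "data_space n = PiM {..<n} (\<lambda>_. borel) \<Otimes>\<^sub>M PiM {..<n} (\<lambda>_. borel)"

definition covariate_law :: "nat \<Rightarrow> real measure \<Rightarrow> (nat \<Rightarrow> real) measure" where
  "covariate_law n \<mu> = PiM {..<n} (\<lambda>_. \<mu>)"

definition error_law :: "nat \<Rightarrow> real \<Rightarrow> (nat \<Rightarrow> real) measure" where
  "error_law n \<sigma> = PiM {..<n} (\<lambda>_. density lborel (normal_density 0 \<sigma>))"

text \<open>Joint law \<open>P\<^sub>\<theta>\<close> of the observed pair \<open>(T, Y)\<close>, for a fixed network.\<close>

definition data_law ::
  "nat \<Rightarrow> (nat \<Rightarrow> nat \<Rightarrow> real) \<Rightarrow> real measure \<Rightarrow> real \<Rightarrow> param
     \<Rightarrow> ((nat \<Rightarrow> real) \<times> (nat \<Rightarrow> real)) measure" where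
  "data_law n A \<mu> \<sigma> \<theta> =
     distr (covariate_law n \<mu> \<Otimes>\<^sub>M error_law n \<sigma>) (data_space n)
       (\<lambda>(T, e). (T, outcome n A \<theta> T e))"

text \<open>In the result the infimum over estimators is taken for each network separately, so the
  dependence of an estimator on the (known) network is left implicit.\<close>

definition estimators :: "nat \<Rightarrow> ((nat \<Rightarrow> real) \<times> (nat \<Rightarrow> real) \<Rightarrow> param) set" where
  "estimators n = borel_measurable (data_space n)"


subsection \<open>The model is well defined\<close>

lemma mat_vec_bound:
  assumes "network n A" "i < n" "\<And>j. j < n \<Longrightarrow> \<bar>x j\<bar> \<le> K"
  shows "\<bar>mat_vec n (row_normalized n A) x i\<bar> \<le> K"
proof -
  have d: "0 < degree n A i" and a: "\<And>j. j < n \<Longrightarrow> 0 \<le> A i j"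
    using assms(1,2) by (auto simp: network_def)
  have "\<bar>mat_vec n (row_normalized n A) x i\<bar> \<le> (\<Sum>j<n. \<bar>row_normalized n A i j * x j\<bar>)"
    unfolding mat_vec_def by (rule sum_abs)
  also have "\<dots> \<le> (\<Sum>j<n. A i j / degree n A i * K)"
    using d a assms(3)
    by (intro sum_mono) (auto simp: abs_mult row_normalized_def intro!: mult_left_mono divide_right_mono)
  also have "\<dots> = (\<Sum>j<n. A i j) / degree n A i * K"
    by (simp add: sum_divide_distrib sum_distrib_right)
  also have "\<dots> = K"
    using d by (simp add: degree_def)
  finally show ?thesis .
qed

definition neumann :: "nat \<Rightarrow> (nat \<Rightarrow> nat \<Rightarrow> real) \<Rightarrow> real \<Rightarrow> (nat \<Rightarrow> real) \<Rightarrow> nat \<Rightarrow> real" where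
  "neumann n M b r i = (\<Sum>k. b ^ k * (mat_vec n M ^^ k) r i)"

lemma neumann_summable:
  assumes "network n A" "\<bar>b\<bar> < 1" "i < n"
  shows "summable (\<lambda>k. b ^ k * (mat_vec n (row_normalized n A) ^^ k) r i)"
proof -
  define K where "K = (\<Sum>j<n. \<bar>r j\<bar>)"
  have 1: "\<bar>(mat_vec n (row_normalized n A) ^^ k) r j\<bar> \<le> K" if "j < n" for j k
    using that
  proof (induction k arbitrary: j)
    case 0
    then show ?case unfolding K_def using member_le_sum[of j "{..<n}" "\<lambda>j. \<bar>r j\<bar>"] by simp
  next
    case (Suc k)
    then show ?case using mat_vec_bound[OF assms(1)] by simp
  qed
  show ?thesis
  proof (rule summable_comparison_test')
    show "summable (\<lambda>k. \<bar>b\<bar> ^ k * K)"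
      using assms(2) by (intro summable_mult2 summable_geometric) simp
    show "norm (b ^ k * (mat_vec n (row_normalized n A) ^^ k) r i) \<le> \<bar>b\<bar> ^ k * K" for k
      using 1[OF assms(3), of k] by (simp add: abs_mult power_abs mult_left_mono)
  qed
qed

lemma neumann_solves:
  assumes "network n A" "\<bar>b\<bar> < 1" "i < n"
  defines "G \<equiv> row_normalized n A"
  shows "neumann n G b r i = r i + b * mat_vec n G (neumann n G b r) i"
proof -
  let ?t = "\<lambda>j k. b ^ k * (mat_vec n G ^^ k) r j"
  have s: "summable (?t j)" if "j < n" for j
    unfolding G_def by (rule neumann_summable[OF assms(1,2) that])
  have "mat_vec n G (neumann n G b r) i = (\<Sum>j<n. \<Sum>k. G i j * ?t j k)"
    unfolding mat_vec_def[of n G "neumann n G b r"] neumann_def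
    by (intro sum.cong refl suminf_mult[symmetric]) (auto intro: s)
  also have "\<dots> = (\<Sum>k. \<Sum>j<n. G i j * ?t j k)"
    by (rule suminf_sum[symmetric]) (auto intro!: summable_mult s)
  also have "(\<lambda>k. \<Sum>j<n. G i j * ?t j k) = (\<lambda>k. b ^ k * (mat_vec n G ^^ Suc k) r i)"
    by (auto simp: mat_vec_def sum_distrib_left mult_ac fun_eq_iff)
  finally have m: "mat_vec n G (neumann n G b r) i = (\<Sum>k. b ^ k * (mat_vec n G ^^ Suc k) r i)" .
  have sc: "summable (\<lambda>k. b ^ k * (mat_vec n G ^^ Suc k) r i)"
    using neumann_summable[OF assms(1-3), of "mat_vec n G r"]
    by (simp add: G_def funpow_swap1)
  have "b * mat_vec n G (neumann n G b r) i = (\<Sum>k. ?t i (Suc k))"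
    unfolding m by (subst suminf_mult[OF sc, symmetric]) (simp add: mult_ac)
  with suminf_split_head[OF s[OF assms(3)]] show ?thesis
    by (simp add: neumann_def)
qed

definition driving :: "nat \<Rightarrow> (nat \<Rightarrow> nat \<Rightarrow> real) \<Rightarrow> param \<Rightarrow> (nat \<Rightarrow> real) \<Rightarrow> (nat \<Rightarrow> real) \<Rightarrow> nat \<Rightarrow> real" where
  "driving n A \<theta> T e i = alpha_of \<theta> + gamma_of \<theta> * T i
     + delta_of \<theta> * mat_vec n (row_normalized n A) T i + e i"

lemma is_outcome_neumann:
  assumes "network n A" "\<theta> \<in> param_space"
  shows "is_outcome n A \<theta> T e
    (restrict (neumann n (row_normalized n A) (beta_of \<theta>) (driving n A \<theta> T e)) {..<n})"
proof -
  have "\<bar>beta_of \<theta>\<bar> < 1" using assms(2) by (auto simp: param_space_def)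
  moreover have "mat_vec n M (restrict x {..<n}) = mat_vec n M x" for M x
    by (auto simp: mat_vec_def)
  ultimately show ?thesis
    using neumann_solves[OF assms(1), of "beta_of \<theta>" _ "driving n A \<theta> T e"]
    by (auto simp: is_outcome_def Let_def driving_def)
qed

lemma is_outcome_unique:
  assumes net: "network n A" and \<theta>: "\<theta> \<in> param_space"
    and "is_outcome n A \<theta> T e Y" "is_outcome n A \<theta> T e Z"
  shows "Y = Z"
proof (rule extensionalityI[of _ "{..<n}"])
  let ?b = "beta_of \<theta>" and ?G = "row_normalized n A"
  define x where "x i = Y i - Z i" for i
  have b: "\<bar>?b\<bar> < 1" using \<theta> by (auto simp: param_space_def)
  show "Y \<in> extensional {..<n}" "Z \<in> extensional {..<n}"
    using assms(3,4) by (auto simp: is_outcome_def)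
  have eq: "x i = ?b * mat_vec n ?G x i" if "i < n" for i
  proof -
    have "mat_vec n ?G x i = mat_vec n ?G Y i - mat_vec n ?G Z i"
      by (simp add: mat_vec_def x_def sum_subtractf right_diff_distrib)
    then have "?b * mat_vec n ?G x i = ?b * mat_vec n ?G Y i - ?b * mat_vec n ?G Z i"
      by (simp add: right_diff_distrib)
    with assms(3,4) that show ?thesis
      by (simp add: is_outcome_def Let_def x_def)
  qed
  fix i assume "i \<in> {..<n}"
  then have i: "i < n" by simp
  define K where "K = Max ((\<lambda>j. \<bar>x j\<bar>) ` {..<n})"
  have K: "\<bar>x j\<bar> \<le> K" if "j < n" for j
    unfolding K_def using that by simp
  have "K \<in> (\<lambda>j. \<bar>x j\<bar>) ` {..<n}"
    unfolding K_def using i by (intro Max_in) auto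
  then obtain j where j: "j < n" "K = \<bar>x j\<bar>" by auto
  have "\<bar>mat_vec n ?G x j\<bar> \<le> K"
    using mat_vec_bound[OF net j(1)] K by blast
  then have "K \<le> \<bar>?b\<bar> * K"
    using eq[OF j(1)] j(2) by (metis abs_ge_zero abs_mult mult_left_mono)
  then have "K \<le> 0"
    using b by (smt (verit) mult_le_cancel_right1)
  with K[OF i] show "Y i = Z i" by (simp add: x_def)
qed

lemma ex1_is_outcome:
  assumes "network n A" "\<theta> \<in> param_space"
  shows "\<exists>!Y. is_outcome n A \<theta> T e Y"
  using is_outcome_neumann[OF assms] is_outcome_unique[OF assms] by blast

lemma outcome_eq_neumann:
  assumes "network n A" "\<theta> \<in> param_space"
  shows "outcome n A \<theta> T e =
    restrict (neumann n (row_normalized n A) (beta_of \<theta>) (driving n A \<theta> T e)) {..<n}"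
  unfolding outcome_def
  by (rule the_equality) (auto intro: is_outcome_neumann[OF assms] is_outcome_unique[OF assms])

lemma measurable_outcome:
  assumes "network n A" "\<theta> \<in> param_space" "sets \<mu> = sets borel"
  shows "(\<lambda>(T, e). (T, outcome n A \<theta> T e))
    \<in> measurable (covariate_law n \<mu> \<Otimes>\<^sub>M error_law n \<sigma>) (data_space n)"
proof -
  let ?M = "PiM {..<n} (\<lambda>_. borel :: real measure) \<Otimes>\<^sub>M PiM {..<n} (\<lambda>_. borel :: real measure)"
  let ?G = "row_normalized n A"
  have s: "sets (covariate_law n \<mu> \<Otimes>\<^sub>M error_law n \<sigma>) = sets ?M"
    unfolding covariate_law_def error_law_def
    by (intro sets_pair_measure_cong sets_PiM_cong) (auto simp: assms(3))
  have d: "(\<lambda>p. driving n A \<theta> (fst p) (snd p) i) \<in> borel_measurable ?M" if "i < n" for i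
  proof -
    have [measurable]: "(\<lambda>p. fst p j) \<in> borel_measurable ?M" "(\<lambda>p. snd p j) \<in> borel_measurable ?M"
      if "j < n" for j
      using that by (auto intro!: measurable_compose[OF measurable_fst] measurable_compose[OF measurable_snd]
        measurable_component_singleton)
    show ?thesis
      unfolding driving_def mat_vec_def using that
      by (intro borel_measurable_add borel_measurable_times borel_measurable_const
          borel_measurable_sum) auto
  qed
  have it: "(\<lambda>p. (mat_vec n ?G ^^ k) (driving n A \<theta> (fst p) (snd p)) i) \<in> borel_measurable ?M"
    if "i < n" for i k
    using that
  proof (induction k arbitrary: i)
    case 0
    then show ?case using d by simp
  next
    case (Suc k)
    then show ?case
      by (simp add: mat_vec_def[of n ?G "(mat_vec n ?G ^^ k) _"])
  qed
  have "(\<lambda>p. outcome n A \<theta> (fst p) (snd p)) \<in> measurable ?M (PiM {..<n} (\<lambda>_. borel))"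
    unfolding outcome_eq_neumann[OF assms(1,2)] neumann_def
    by (intro measurable_restrict borel_measurable_suminf borel_measurable_times it) auto
  then have "(\<lambda>p. (fst p, outcome n A \<theta> (fst p) (snd p))) \<in> measurable ?M (data_space n)"
    unfolding data_space_def by measurable
  then show ?thesis
    by (simp add: case_prod_beta' measurable_cong_sets[OF s refl])
qed

lemma prob_space_data_law:
  assumes "network n A" "\<theta> \<in> param_space" "real_distribution \<mu>" "0 < \<sigma>"
  shows "prob_space (data_law n A \<mu> \<sigma> \<theta>)"
proof -
  interpret m: real_distribution \<mu> by fact
  interpret T: prob_space "covariate_law n \<mu>"
    unfolding covariate_law_def by (intro prob_space_PiM m.prob_space_axioms)
  interpret e: prob_space "error_law n \<sigma>"
    unfolding error_law_def by (intro prob_space_PiM prob_space_normal_density assms(4))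
  interpret P: pair_prob_space "covariate_law n \<mu>" "error_law n \<sigma>" ..
  show ?thesis
    unfolding data_law_def
    by (rule P.prob_space_distr[OF measurable_outcome[OF assms(1,2)]]) simp
qed

end

theory Submission
  imports Defs
begin

text \<open>Taking \<open>\<gamma> = 1\<close>, \<open>\<delta> = - \<beta>\<close> and \<open>\<alpha> = 1 - \<beta>\<close> makes the mean of \<open>Y\<close> given \<open>T\<close> equal to
  \<open>1 + T\<close> for every \<open>\<beta>\<close>, because \<open>G\<close> fixes the all-ones vector; so \<open>\<beta>\<close> is visible only through the
  covariance of \<open>(I - \<beta>G)\<^sup>-\<^sup>1 \<epsilon>\<close>. With \<open>H = G (I - \<beta>G)\<^sup>-\<^sup>1\<close>, the symmetrised Kullback-Leibler divergence
  between the laws of \<open>\<epsilon>\<close> and \<open>(I - \<beta>G)\<^sup>-\<^sup>1 \<epsilon>\<close> is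
  \<open>\<beta>\<^sup>2 (\<parallel>G\<parallel>\<^sup>2 + \<parallel>H\<parallel>\<^sup>2 + 2 tr (GH)) / 2\<close>, of order \<open>\<beta>\<^sup>2 \<parallel>G\<parallel>\<^sup>2\<close> in the Frobenius norm. Hence
  \<open>\<beta> \<in> {0, \<plusminus> 1 / (8 \<parallel>G\<parallel>)}\<close> gives three parameters that are hard to tell apart pairwise. An
  estimator of \<open>\<beta>\<close> can be good at no more than one of them, likewise one of \<open>\<delta>\<close>, so at the remaining
  one both fail. Two points suffice for \<open>\<alpha>\<close>.\<close>

section \<open>Lebesgue measure on extensional vectors and invertible linear maps\<close>

abbreviation lborel_pow :: "nat \<Rightarrow> (nat \<Rightarrow> real) measure" where
  "lborel_pow n \<equiv> PiM {..<n} (\<lambda>_. lborel)"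

definition mat_map :: "nat \<Rightarrow> (nat \<Rightarrow> nat \<Rightarrow> real) \<Rightarrow> (nat \<Rightarrow> real) \<Rightarrow> nat \<Rightarrow> real" where
  "mat_map n M x = restrict (mat_vec n M x) {..<n}"

text \<open>Inverse as maps on the points of \<open>lborel_pow\<close>. Both directions are
  included, so the roles of \<open>M\<close> and \<open>R\<close> can be exchanged.\<close>

definition mutually_inverse :: "nat \<Rightarrow> (nat \<Rightarrow> nat \<Rightarrow> real) \<Rightarrow> (nat \<Rightarrow> nat \<Rightarrow> real) \<Rightarrow> bool" where
  "mutually_inverse n M R \<longleftrightarrow>
     (\<forall>x\<in>extensional {..<n}. mat_map n M (mat_map n R x) = x \<and> mat_map n R (mat_map n M x) = x)"

lemma mutually_inverse_sym: "mutually_inverse n M R \<Longrightarrow> mutually_inverse n R M"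
  by (auto simp: mutually_inverse_def)

interpretation lborel_product: product_sigma_finite "\<lambda>_::nat. lborel :: real measure"
  by standard

lemma sets_lborel_pow: "sets (lborel_pow n) = sets (PiM {..<n} (\<lambda>_. borel))"
  by (intro sets_PiM_cong) auto

lemma space_lborel_pow: "space (lborel_pow n) = extensional {..<n}"
  by (auto simp: space_PiM PiE_def)

lemma measurable_mat_map [measurable]:
  "mat_map n M \<in> measurable (PiM {..<n} (\<lambda>_. borel)) (PiM {..<n} (\<lambda>_. borel))"
  unfolding mat_map_def mat_vec_def by measurable

lemma measurable_mat_map_lborel [measurable]:
  "mat_map n M \<in> measurable (lborel_pow n) (lborel_pow n)"
  using measurable_mat_map by (simp cong: measurable_cong_sets add: sets_lborel_pow)

lemma mat_map_add:
  "mat_map n M (\<lambda>i\<in>{..<n}. x i + y i) = (\<lambda>i\<in>{..<n}. mat_map n M x i + mat_map n M y i)"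
  by (auto simp: mat_map_def mat_vec_def fun_eq_iff distrib_left sum.distrib)

text \<open>The product measure is determined by its values on boxes. The preimage of a box under a
  translation is the box of the translated sides, so invariance reduces to the real line.\<close>

lemma distr_lborel_pow_translate:
  "distr (lborel_pow n) (lborel_pow n) (\<lambda>x. \<lambda>i\<in>{..<n}. x i + v i) = lborel_pow n"
proof (rule lborel_product.PiM_eqI)
  fix A assume A: "\<And>i. i \<in> {..<n} \<Longrightarrow> A i \<in> sets (lborel :: real measure)"
  have B: "(\<lambda>t. t + v i) -` A i \<in> sets lborel" "emeasure lborel ((\<lambda>t. t + v i) -` A i) = emeasure lborel (A i)"
    if "i < n" for i
  proof -
    have Ai: "A i \<in> sets borel" using A that by simp
    have ac: "(\<lambda>t. t + v i) = (+) (v i)" by (auto simp: fun_eq_iff)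
    have m: "(\<lambda>t. t + v i) \<in> borel_measurable borel" by measurable
    show "(\<lambda>t. t + v i) -` A i \<in> sets lborel"
      using measurable_sets[OF m Ai] by simp
    have "emeasure lborel (A i) = emeasure (distr lborel borel ((+) (v i))) (A i)"
      by (simp add: lborel_distr_plus)
    also have "\<dots> = emeasure lborel ((+) (v i) -` A i)"
      using Ai by (subst emeasure_distr) auto
    finally show "emeasure lborel ((\<lambda>t. t + v i) -` A i) = emeasure lborel (A i)"
      by (simp add: ac)
  qed
  have m: "(\<lambda>x. \<lambda>i\<in>{..<n}. x i + v i) \<in> measurable (lborel_pow n) (lborel_pow n)"
    by measurable
  have eq: "(\<lambda>x. \<lambda>i\<in>{..<n}. x i + v i) -` Pi\<^sub>E {..<n} A \<inter> space (lborel_pow n)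
      = Pi\<^sub>E {..<n} (\<lambda>i. (\<lambda>t. t + v i) -` A i)"
    by (auto simp: space_PiM PiE_iff)
  have "emeasure (lborel_pow n) (Pi\<^sub>E {..<n} (\<lambda>i. (\<lambda>t. t + v i) -` A i))
      = (\<Prod>i<n. emeasure lborel ((\<lambda>t. t + v i) -` A i))"
    by (rule lborel_product.emeasure_PiM) (use B in auto)
  then show "emeasure (distr (lborel_pow n) (lborel_pow n) (\<lambda>x. \<lambda>i\<in>{..<n}. x i + v i)) (Pi\<^sub>E {..<n} A)
      = (\<Prod>i<n. emeasure lborel (A i))"
    using A B by (subst emeasure_distr[OF m]) (simp_all add: eq sets_PiM_I_finite)
qed auto

lemma nn_integral_lborel_pow_translate:
  assumes [measurable]: "f \<in> borel_measurable (lborel_pow n)"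
  shows "(\<integral>\<^sup>+x. f (\<lambda>i\<in>{..<n}. x i + v i) \<partial>lborel_pow n) = (\<integral>\<^sup>+x. f x \<partial>lborel_pow n)"
proof -
  have "(\<integral>\<^sup>+x. f x \<partial>lborel_pow n)
      = (\<integral>\<^sup>+x. f x \<partial>distr (lborel_pow n) (lborel_pow n) (\<lambda>x. \<lambda>i\<in>{..<n}. x i + v i))"
    by (simp add: distr_lborel_pow_translate)
  also have "\<dots> = (\<integral>\<^sup>+x. f (\<lambda>i\<in>{..<n}. x i + v i) \<partial>lborel_pow n)"
    by (rule nn_integral_distr) measurable
  finally show ?thesis ..
qed

text \<open>The uniqueness argument for Haar measure: no determinant is computed, the Jacobian is only known
  as the integral on the right.\<close>

lemma nn_integral_mat_map:
  assumes inv: "mutually_inverse n M R"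
    and [measurable]: "f \<in> borel_measurable (lborel_pow n)" "g \<in> borel_measurable (lborel_pow n)"
    and g: "(\<integral>\<^sup>+x. g x \<partial>lborel_pow n) = 1"
  shows "(\<integral>\<^sup>+x. f (mat_map n M x) \<partial>lborel_pow n)
    = (\<integral>\<^sup>+x. g (\<lambda>i\<in>{..<n}. - mat_map n M x i) \<partial>lborel_pow n) * (\<integral>\<^sup>+x. f x \<partial>lborel_pow n)"
proof -
  let ?L = "lborel_pow n" and ?M = "mat_map n M"
  interpret L: sigma_finite_measure ?L
    by (rule lborel_product.sigma_finite) simp
  interpret LL: pair_sigma_finite ?L ?L ..
  have meas [measurable]: "(\<lambda>p. \<lambda>i\<in>{..<n}. snd p i - ?M (fst p) i) \<in> measurable (?L \<Otimes>\<^sub>M ?L) ?L"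
    "(\<lambda>p. \<lambda>i\<in>{..<n}. snd p i + ?M (fst p) i) \<in> measurable (?L \<Otimes>\<^sub>M ?L) ?L"
    by measurable
  have neg [measurable]: "(\<lambda>x. \<lambda>i\<in>{..<n}. - ?M x i) \<in> measurable ?L ?L"
    by measurable
  \<comment> \<open>\<open>g\<close> is an auxiliary weight of total mass 1. Translating it by
    \<open>mat_map n M x\<close> keeps the mass, so it can be inserted as a factor for every
    \<open>x\<close>.\<close>
  have 1: "(\<integral>\<^sup>+y. g (\<lambda>i\<in>{..<n}. y i - ?M x i) \<partial>?L) = 1" for x
    using nn_integral_lborel_pow_translate[of g n "\<lambda>i. - ?M x i"] g by simp
  have "(\<integral>\<^sup>+x. f (?M x) \<partial>?L) = (\<integral>\<^sup>+x. f (?M x) * (\<integral>\<^sup>+y. g (\<lambda>i\<in>{..<n}. y i - ?M x i) \<partial>?L) \<partial>?L)"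
    by (simp add: 1)
  also have "\<dots> = (\<integral>\<^sup>+x. \<integral>\<^sup>+y. f (?M x) * g (\<lambda>i\<in>{..<n}. y i - ?M x i) \<partial>?L \<partial>?L)"
    by (intro nn_integral_cong nn_integral_cmult[symmetric]) measurable
  also have "\<dots> = (\<integral>\<^sup>+y. \<integral>\<^sup>+x. f (?M x) * g (\<lambda>i\<in>{..<n}. y i - ?M x i) \<partial>?L \<partial>?L)"
    by (intro LL.Fubini'[symmetric]) measurable
  \<comment> \<open>For fixed \<open>y\<close>, replacing \<open>x\<close> by \<open>x + R y\<close>
    turns \<open>M x\<close> into \<open>y + M x\<close>. The shift cancels inside \<open>g\<close>,
    and \<open>y\<close> is left only in \<open>f\<close>.\<close>
  also have "\<dots> = (\<integral>\<^sup>+y. \<integral>\<^sup>+x. f (\<lambda>i\<in>{..<n}. y i + ?M x i) * g (\<lambda>i\<in>{..<n}. - ?M x i) \<partial>?L \<partial>?L)"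
  proof (rule nn_integral_cong)
    fix y assume "y \<in> space ?L"
    then have My: "?M (mat_map n R y) = y"
      using inv by (auto simp: mutually_inverse_def space_lborel_pow)
    have "(\<integral>\<^sup>+x. f (?M x) * g (\<lambda>i\<in>{..<n}. y i - ?M x i) \<partial>?L)
      = (\<integral>\<^sup>+x. f (?M (\<lambda>i\<in>{..<n}. x i + mat_map n R y i))
           * g (\<lambda>i\<in>{..<n}. y i - ?M (\<lambda>i\<in>{..<n}. x i + mat_map n R y i) i) \<partial>?L)"
      by (rule nn_integral_lborel_pow_translate[symmetric]) measurable
    also have "\<dots> = (\<integral>\<^sup>+x. f (\<lambda>i\<in>{..<n}. y i + ?M x i) * g (\<lambda>i\<in>{..<n}. - ?M x i) \<partial>?L)"
      by (intro nn_integral_cong arg_cong2[of _ _ _ _ "(*)"] arg_cong[of _ _ f] arg_cong[of _ _ g])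
        (auto simp: mat_map_add My fun_eq_iff)
    finally show "(\<integral>\<^sup>+x. f (?M x) * g (\<lambda>i\<in>{..<n}. y i - ?M x i) \<partial>?L) = \<dots>" .
  qed
  also have "\<dots> = (\<integral>\<^sup>+x. \<integral>\<^sup>+y. f (\<lambda>i\<in>{..<n}. y i + ?M x i) * g (\<lambda>i\<in>{..<n}. - ?M x i) \<partial>?L \<partial>?L)"
    by (intro LL.Fubini') measurable
  also have "\<dots> = (\<integral>\<^sup>+x. (\<integral>\<^sup>+y. f (\<lambda>i\<in>{..<n}. y i + ?M x i) \<partial>?L) * g (\<lambda>i\<in>{..<n}. - ?M x i) \<partial>?L)"
    by (intro nn_integral_cong nn_integral_multc) measurable
  also have "\<dots> = (\<integral>\<^sup>+x. (\<integral>\<^sup>+y. f y \<partial>?L) * g (\<lambda>i\<in>{..<n}. - ?M x i) \<partial>?L)"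
    by (simp add: nn_integral_lborel_pow_translate)
  also have "\<dots> = (\<integral>\<^sup>+y. f y \<partial>?L) * (\<integral>\<^sup>+x. g (\<lambda>i\<in>{..<n}. - ?M x i) \<partial>?L)"
    by (intro nn_integral_cmult) measurable
  finally show ?thesis by (simp add: mult.commute)
qed

section \<open>Gaussian vectors and their linear images\<close>

definition normal_pow :: "nat \<Rightarrow> real \<Rightarrow> (nat \<Rightarrow> real) \<Rightarrow> real" where
  "normal_pow n \<sigma> x = (\<Prod>i<n. normal_density 0 \<sigma> (x i))"

lemma measurable_normal_pow [measurable]: "normal_pow n \<sigma> \<in> borel_measurable (lborel_pow n)"
  unfolding normal_pow_def by measurable

lemma normal_pow_pos: "0 < \<sigma> \<Longrightarrow> 0 < normal_pow n \<sigma> x"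
  unfolding normal_pow_def by (intro prod_pos) (auto simp: normal_density_pos)

text \<open>Both measures agree on boxes: the indicator of a box and \<open>normal_pow\<close> are
  products over the coordinates, so the integral over a box splits into one-dimensional
  integrals.\<close>

lemma error_law_eq_density:
  assumes "0 < \<sigma>"
  shows "error_law n \<sigma> = density (lborel_pow n) (normal_pow n \<sigma>)"
proof -
  interpret N: product_sigma_finite "\<lambda>_::nat. density lborel (normal_density 0 \<sigma>)"
    by (intro product_sigma_finite.intro prob_space_imp_sigma_finite prob_space_normal_density assms)
  show ?thesis
    unfolding error_law_def
  proof (rule N.PiM_eqI[symmetric])
    show "sets (density (lborel_pow n) (normal_pow n \<sigma>))
        = sets (PiM {..<n} (\<lambda>_. density lborel (normal_density 0 \<sigma>)))"
      by (simp cong: sets_PiM_cong)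
    fix A assume A: "\<And>i. i \<in> {..<n} \<Longrightarrow> A i \<in> sets (density lborel (normal_density 0 \<sigma>))"
    then have [measurable]: "i < n \<Longrightarrow> A i \<in> sets borel" for i by simp
    have P: "Pi\<^sub>E {..<n} A \<in> sets (lborel_pow n)"
      by (intro sets_PiM_I_finite) auto
    have "emeasure (density (lborel_pow n) (normal_pow n \<sigma>)) (Pi\<^sub>E {..<n} A)
       = (\<integral>\<^sup>+x. ennreal (normal_pow n \<sigma> x) * indicator (Pi\<^sub>E {..<n} A) x \<partial>lborel_pow n)"
      using P by (subst emeasure_density) auto
    also have "\<dots> = (\<integral>\<^sup>+x. (\<Prod>i<n. ennreal (normal_density 0 \<sigma> (x i)) * indicator (A i) (x i)) \<partial>lborel_pow n)"
    proof (intro nn_integral_cong)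
      fix x assume x: "x \<in> space (lborel_pow n)"
      have "indicator (Pi\<^sub>E {..<n} A) x = (\<Prod>i<n. indicator (A i) (x i) :: ennreal)"
        using x by (auto simp: indicator_def space_lborel_pow PiE_iff)
      then show "ennreal (normal_pow n \<sigma> x) * indicator (Pi\<^sub>E {..<n} A) x
          = (\<Prod>i<n. ennreal (normal_density 0 \<sigma> (x i)) * indicator (A i) (x i))"
        by (simp add: normal_pow_def prod.distrib prod_ennreal)
    qed
    also have "\<dots> = (\<Prod>i<n. \<integral>\<^sup>+t. ennreal (normal_density 0 \<sigma> t) * indicator (A i) t \<partial>lborel)"
      by (intro lborel_product.product_nn_integral_prod) auto
    also have "\<dots> = (\<Prod>i<n. emeasure (density lborel (normal_density 0 \<sigma>)) (A i))"
      by (intro prod.cong refl emeasure_density[symmetric]) auto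
    finally show "emeasure (density (lborel_pow n) (normal_pow n \<sigma>)) (Pi\<^sub>E {..<n} A) = \<dots>" .
  qed simp
qed

lemma nn_integral_normal_pow:
  assumes "0 < \<sigma>"
  shows "(\<integral>\<^sup>+x. ennreal (normal_pow n \<sigma> x) \<partial>lborel_pow n) = 1"
proof -
  interpret prob_space "error_law n \<sigma>"
    unfolding error_law_def by (intro prob_space_PiM prob_space_normal_density assms)
  have "emeasure (error_law n \<sigma>) (space (error_law n \<sigma>)) = 1"
    by (rule emeasure_space_1)
  then show ?thesis
    by (simp add: error_law_eq_density[OF assms] emeasure_density cong: nn_integral_cong)
qed

text \<open>\<open>M\<close> and \<open>R\<close> compose to the identity, so the factors that
  \<open>nn_integral_mat_map\<close> gives for them multiply to 1 and neither is 0 or infinite. The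
  weight is the standard Gaussian density.\<close>

lemma nn_integral_mat_map_const:
  assumes inv: "mutually_inverse n M R"
  obtains c :: real where "0 < c"
    "\<And>f. f \<in> borel_measurable (lborel_pow n) \<Longrightarrow>
       (\<integral>\<^sup>+x. f (mat_map n M x) \<partial>lborel_pow n) = ennreal c * (\<integral>\<^sup>+x. f x \<partial>lborel_pow n)"
proof -
  let ?L = "lborel_pow n" 
  let ?g = "\<lambda>x. ennreal (normal_pow n 1 x)"
  define C where "C K = (\<integral>\<^sup>+x. ?g (\<lambda>i\<in>{..<n}. - mat_map n K x i) \<partial>?L)" for K
  have g [measurable]: "?g \<in> borel_measurable ?L" by measurable
  have g1: "(\<integral>\<^sup>+x. ?g x \<partial>?L) = 1" by (rule nn_integral_normal_pow) simp
  note * = nn_integral_mat_map[OF _ _ g g1, folded C_def]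
  have "1 = (\<integral>\<^sup>+x. ?g (mat_map n M (mat_map n R x)) \<partial>?L)"
    unfolding g1[symmetric] using inv
    by (intro nn_integral_cong) (auto simp: mutually_inverse_def space_lborel_pow)
  also have "\<dots> = C R * (\<integral>\<^sup>+x. ?g (mat_map n M x) \<partial>?L)"
    by (rule *[OF mutually_inverse_sym[OF inv], of "\<lambda>x. ?g (mat_map n M x)"]) measurable
  also have "\<dots> = C R * (C M * 1)"
    using *[OF inv g] g1 by simp
  finally have CC: "C R * C M = 1" by simp
  have "C M \<noteq> \<top>" "C M \<noteq> 0"
    using CC by (auto simp: ennreal_mult_top top_unique split: if_splits)
  then obtain c where c: "C M = ennreal c" "0 < c"
    by (cases "C M") (auto simp: less_le)
  show thesis
    by (rule that[OF c(2)]) (auto simp: *[OF inv] c(1))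
qed

text \<open>The normalising constants cancel in each coordinate, so the ratio depends only on
  squared Euclidean norms.\<close>

lemma normal_pow_ratio:
  assumes "0 < \<sigma>"
  shows "normal_pow n \<sigma> x = normal_pow n \<sigma> y * exp (- ((\<Sum>i<n. (x i)\<^sup>2) - (\<Sum>i<n. (y i)\<^sup>2)) / (2 * \<sigma>\<^sup>2))"
proof -
  have "normal_density 0 \<sigma> (x i) = normal_density 0 \<sigma> (y i) * exp (- ((x i)\<^sup>2 - (y i)\<^sup>2) / (2 * \<sigma>\<^sup>2))" for i
    using assms by (simp add: normal_density_def mult_exp_exp field_simps)
  then show ?thesis
    by (simp add: normal_pow_def prod.distrib exp_sum[symmetric] sum_divide_distrib[symmetric] sum_subtractf
      sum_negf)
qed

text \<open>Change of variables: the density of \<open>R e\<close> at \<open>x\<close> is the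
  Gaussian density at \<open>M x\<close> times a Jacobian factor \<open>c\<close>. Dividing by the
  Gaussian density at \<open>x\<close> leaves the exponential.\<close>

lemma distr_error_law_mat_map:
  assumes inv: "mutually_inverse n M R" and s: "0 < \<sigma>"
  obtains c where "0 < c"
    "distr (error_law n \<sigma>) (error_law n \<sigma>) (mat_map n R) = density (error_law n \<sigma>)
       (\<lambda>x. ennreal (c * exp (- ((\<Sum>i<n. (mat_map n M x i)\<^sup>2) - (\<Sum>i<n. (x i)\<^sup>2)) / (2 * \<sigma>\<^sup>2))))"
proof -
  let ?L = "lborel_pow n" and ?P = "error_law n \<sigma>" and ?g = "normal_pow n \<sigma>"
  let ?e = "\<lambda>x. exp (- ((\<Sum>i<n. (mat_map n M x i)\<^sup>2) - (\<Sum>i<n. (x i)\<^sup>2)) / (2 * \<sigma>\<^sup>2))"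
  obtain c where c: "0 < c" "\<And>f. f \<in> borel_measurable ?L \<Longrightarrow>
       (\<integral>\<^sup>+x. f (mat_map n R x) \<partial>?L) = ennreal c * (\<integral>\<^sup>+x. f x \<partial>?L)"
    using nn_integral_mat_map_const[OF mutually_inverse_sym[OF inv]] by blast
  have P: "?P = density ?L ?g" by (rule error_law_eq_density[OF s])
  have e[measurable]: "?e \<in> borel_measurable ?L"
    by measurable
  have sets: "sets ?P = sets ?L" by (simp add: P)
  show thesis
  proof (rule that[OF c(1)], rule measure_eqI)
    fix B assume "B \<in> sets (distr ?P ?P (mat_map n R))"
    then have B[measurable]: "B \<in> sets ?L" by (simp add: P)
    have mR: "mat_map n R \<in> measurable ?P ?P"
      by (simp add: P)
    have "emeasure (distr ?P ?P (mat_map n R)) B = (\<integral>\<^sup>+x. indicator B x \<partial>distr ?P ?P (mat_map n R))"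
      by (simp add: sets B)
    also have "\<dots> = (\<integral>\<^sup>+x. indicator B (mat_map n R x) \<partial>?P)"
      by (intro nn_integral_distr[OF mR] borel_measurable_indicator) (simp add: sets)
    also have "\<dots> = (\<integral>\<^sup>+x. ennreal (?g x) * indicator B (mat_map n R x) \<partial>?L)"
      unfolding P by (rule nn_integral_density) measurable
    \<comment> \<open>Writing \<open>x\<close> as \<open>M (R x)\<close> makes the whole integrand a
      function of \<open>R x\<close>, as the change of variables requires.\<close>
    also have "\<dots> = (\<integral>\<^sup>+x. ennreal (?g (mat_map n M (mat_map n R x))) * indicator B (mat_map n R x) \<partial>?L)"
      using inv by (intro nn_integral_cong) (auto simp: mutually_inverse_def space_lborel_pow)
    also have "\<dots> = ennreal c * (\<integral>\<^sup>+x. ennreal (?g (mat_map n M x)) * indicator B x \<partial>?L)"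
      by (rule c(2)) measurable
    also have "\<dots> = (\<integral>\<^sup>+x. ennreal c * (ennreal (?g (mat_map n M x)) * indicator B x) \<partial>?L)"
      by (rule nn_integral_cmult[symmetric]) measurable
    also have "\<dots> = (\<integral>\<^sup>+x. ennreal (?g x) * (ennreal (c * ?e x) * indicator B x) \<partial>?L)"
      using c(1) normal_pow_pos[OF s]
      by (intro nn_integral_cong, subst normal_pow_ratio[OF s, of n "mat_map n M _"])
        (simp add: ennreal_mult less_imp_le mult_ac)
    also have "\<dots> = (\<integral>\<^sup>+x. ennreal (c * ?e x) * indicator B x \<partial>?P)"
      unfolding P by (rule nn_integral_density[symmetric]) measurable
    also have "\<dots> = emeasure (density ?P (\<lambda>x. ennreal (c * ?e x))) B"
      by (rule emeasure_density[symmetric]) (auto simp: P)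
    finally show "emeasure (distr ?P ?P (mat_map n R)) B = \<dots>" .
  qed simp
qed


section \<open>Second moments of the errors\<close>

text \<open>The monomial is rewritten with one power for each coordinate, so that its expectation
  under the product measure factorises into Gaussian moments of order 0, 1 or 2.\<close>

lemma has_bochner_integral_error_law_coords:
  assumes s: "0 < \<sigma>" and jk: "j < n" "k < n"
  shows "has_bochner_integral (error_law n \<sigma>) (\<lambda>x. x j * x k) (if j = k then \<sigma>\<^sup>2 else 0)"
proof -
  let ?N = "density lborel (normal_density 0 \<sigma>)"
  interpret N: product_sigma_finite "\<lambda>_::nat. ?N"
    by (intro product_sigma_finite.intro prob_space_imp_sigma_finite prob_space_normal_density s)
  have moment: "has_bochner_integral ?N (\<lambda>t. t ^ m) v"
    if "has_bochner_integral lborel (\<lambda>t. normal_density 0 \<sigma> t * t ^ m) v" for m v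
    using that by (intro has_bochner_integral_density) (auto simp: normal_density_nonneg)
  have m0: "has_bochner_integral ?N (\<lambda>t. t ^ 0) 1"
    using normal_moment_even[OF s, of 0 0] by (intro moment) simp
  have m1: "has_bochner_integral ?N (\<lambda>t. t ^ 1) 0"
    using normal_moment_nz_1[OF s, of 0] by (intro moment) simp
  have m2: "has_bochner_integral ?N (\<lambda>t. t ^ 2) (\<sigma>\<^sup>2)"
    using normal_moment_even[OF s, of 0 1] by (intro moment) (simp add: fact_numeral)
  \<comment> \<open>\<open>p i\<close> counts the occurrences of \<open>i\<close> among
    \<open>j\<close> and \<open>k\<close>; \<open>v i\<close> is the matching moment 1, 0 or
    \<open>\<sigma>\<^sup>2\<close>.\<close>
  define p where "p i = of_bool (i = j) + (of_bool (i = k) :: nat)" for i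
  define v where "v i = (if p i = 0 then 1 else if p i = 1 then 0 else \<sigma>\<^sup>2)" for i
  have pv: "has_bochner_integral ?N (\<lambda>t. t ^ p i) (v i)" for i
  proof -
    have "p i = 0 \<or> p i = 1 \<or> p i = 2"
      by (cases "i = j"; cases "i = k") (simp_all add: p_def)
    then show ?thesis
      by (elim disjE) (use m0 m1 m2 in \<open>simp_all add: v_def\<close>)
  qed
  have p: "(\<Prod>i<n. x i ^ p i) = x j * x k" for x :: "nat \<Rightarrow> real"
  proof -
    have "(\<Prod>i<n. x i ^ p i) = (\<Prod>i<n. if i = j then x i else 1) * (\<Prod>i<n. if i = k then x i else 1)"
      unfolding prod.distrib[symmetric] by (intro prod.cong) (auto simp: p_def)
    then show ?thesis using jk by (simp add: prod.delta)
  qed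
  have v: "(\<Prod>i<n. v i) = (if j = k then \<sigma>\<^sup>2 else 0)"
  proof (cases "j = k")
    case True
    then have "(\<Prod>i<n. v i) = (\<Prod>i<n. if i = j then \<sigma>\<^sup>2 else 1)"
      by (intro prod.cong) (auto simp: v_def p_def)
    then show ?thesis using True jk by (simp add: prod.delta)
  next
    case False
    then have "v j = 0" by (simp add: v_def p_def)
    then have "(\<Prod>i<n. v i) = 0" using jk by (intro prod_zero) auto
    then show ?thesis using False by simp
  qed
  have int: "integrable ?N (\<lambda>t. t ^ p i)" for i
    using pv by (rule integrable.intros)
  have eq: "(\<integral>t. t ^ p i \<partial>?N) = v i" for i
    using pv by (rule has_bochner_integral_integral_eq)
  have "integrable (error_law n \<sigma>) (\<lambda>x. \<Prod>i<n. x i ^ p i)"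
    unfolding error_law_def by (rule N.product_integrable_prod) (auto intro: int)
  moreover have "(\<integral>x. (\<Prod>i<n. x i ^ p i) \<partial>error_law n \<sigma>) = (\<Prod>i<n. v i)"
    unfolding error_law_def eq[symmetric] by (rule N.product_integral_prod) (auto intro: int)
  ultimately show ?thesis
    by (simp only: has_bochner_integral_iff p v)
qed

text \<open>Bilinear expansion; the coordinates are uncorrelated, so only the diagonal terms
  survive.\<close>

lemma has_bochner_integral_error_law_linear_forms:
  assumes "0 < \<sigma>"
  shows "has_bochner_integral (error_law n \<sigma>) (\<lambda>x. (\<Sum>j<n. a j * x j) * (\<Sum>k<n. b k * x k))
    (\<sigma>\<^sup>2 * (\<Sum>j<n. a j * b j))"
proof -
  have "has_bochner_integral (error_law n \<sigma>) (\<lambda>x. \<Sum>j<n. \<Sum>k<n. (a j * b k) * (x j * x k))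
    (\<Sum>j<n. \<Sum>k<n. (a j * b k) * (if j = k then \<sigma>\<^sup>2 else 0))"
    by (intro has_bochner_integral_sum has_bochner_integral_mult_right
        has_bochner_integral_error_law_coords assms) auto
  moreover have "(\<Sum>j<n. \<Sum>k<n. (a j * b k) * (if j = k then \<sigma>\<^sup>2 else 0)) = \<sigma>\<^sup>2 * (\<Sum>j<n. a j * b j)"
    by (simp add: sum_distrib_left mult_ac if_distrib[of "\<lambda>z. _ * z"] cong: if_cong)
  ultimately show ?thesis
    by (simp add: sum_product mult_ac)
qed

section \<open>Closeness of laws from the symmetrised divergence\<close>

text \<open>A Pinsker-type bound; the integral is the sum of the two Kullback-Leibler divergences.
  On the complement of \<open>B\<close> the difference of the measures is the integral of
  \<open>1 - L\<close>, to which only points with \<open>L < 1\<close> contribute positively. There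
  the integrand of the divergence dominates the square of \<open>L - 1\<close>, which it does not
  for \<open>L > 1\<close>.\<close>

lemma measure_density_le_jeffreys:
  assumes "prob_space P" and [measurable]: "L \<in> borel_measurable P" and pos: "\<And>x. 0 < L x"
    and Q: "prob_space (density P (\<lambda>x. ennreal (L x)))"
    and int: "integrable P (\<lambda>x. (L x - 1) * ln (L x))"
    and J: "(\<integral>x. (L x - 1) * ln (L x) \<partial>P) \<le> 1 / 16"
    and [measurable]: "B \<in> sets P"
  shows "measure (density P (\<lambda>x. ennreal (L x))) B \<le> measure P B + 1 / 4"
proof -
  interpret P: prob_space P by fact
  interpret Q: prob_space "density P (\<lambda>x. ennreal (L x))" by fact
  let ?Q = "density P (\<lambda>x. ennreal (L x))" and ?C = "space P - B"
  have "(\<integral>\<^sup>+x. ennreal (L x) \<partial>P) = 1"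
    using Q.emeasure_space_1 by (simp add: emeasure_density cong: nn_integral_cong)
  then have iL: "integrable P L"
    using pos by (intro integrableI_nonneg) (auto simp: less_imp_le)
  have iLC: "integrable P (\<lambda>x. indicator ?C x * L x)"
    using integrable_mult_indicator[OF _ iL, of ?C] by simp
  have QC: "measure ?Q ?C = (\<integral>x. indicator ?C x * L x \<partial>P)"
  proof -
    have "measure ?Q ?C = (\<integral>x. indicator ?C x \<partial>?Q)"
      by simp
    also have "\<dots> = (\<integral>x. indicator ?C x * L x \<partial>P)"
      using pos by (subst integral_density) (auto simp: less_imp_le mult.commute)
    finally show ?thesis .
  qed
  have PC: "measure P ?C = (\<integral>x. indicator ?C x \<partial>P)" by simp
  have iC: "integrable P (indicat_real ?C)"
    by (simp add: integrable_indicator_iff P.emeasure_finite less_top[symmetric])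
  \<comment> \<open>The constants make the integrated bound
    \<open>1 / 8 + 2 / 16 = 1 / 4\<close>.\<close>
  have bound: "indicator ?C x - indicator ?C x * L x \<le> 1 / 8 + 2 * ((L x - 1) * ln (L x))" for x
  proof -
    let ?l = "L x"
    have ln: "(?l - 1)\<^sup>2 \<le> (?l - 1) * ln ?l" if "?l < 1"
    proof -
      have "ln ?l \<le> ?l - 1" using pos[of x] by (rule ln_le_minus_one)
      then have "(1 - ?l) * (1 - ?l) \<le> (1 - ?l) * (- ln ?l)"
        using that by (intro mult_left_mono) auto
      then show ?thesis by (simp add: power2_eq_square algebra_simps)
    qed
    have nonneg: "0 \<le> (?l - 1) * ln ?l"
      using pos[of x] by (cases "?l < 1") (auto simp: mult_nonneg_nonneg mult_nonpos_nonpos)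
    show ?thesis
    proof (cases "x \<in> ?C \<and> ?l < 1")
      case True
      \<comment> \<open>With \<open>t = 1 - ?l\<close> this square expands to
        \<open>2 * t\<^sup>2 - t + 1 / 8\<close>.\<close>
      have "0 \<le> 2 * (1 - ?l - 1 / 4)\<^sup>2" by simp
      then have "1 - ?l \<le> 1 / 8 + 2 * (?l - 1)\<^sup>2"
        by (simp add: power2_eq_square algebra_simps)
      then show ?thesis using True ln by simp
    next
      case False
      then have "indicator ?C x - indicator ?C x * L x \<le> 0"
        by (auto simp: indicator_def)
      then show ?thesis using nonneg by simp
    qed
  qed
  have "measure P ?C - measure ?Q ?C = (\<integral>x. indicator ?C x - indicator ?C x * L x \<partial>P)"
    unfolding PC QC by (rule Bochner_Integration.integral_diff[symmetric, OF iC iLC])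
  also have "\<dots> \<le> (\<integral>x. 1 / 8 + 2 * ((L x - 1) * ln (L x)) \<partial>P)"
    using int by (intro integral_mono bound Bochner_Integration.integrable_diff iC iLC
        Bochner_Integration.integrable_add integrable_mult_right) auto
  also have "\<dots> = 1 / 8 + 2 * (\<integral>x. (L x - 1) * ln (L x) \<partial>P)"
    using int by (subst Bochner_Integration.integral_add) (auto simp: P.prob_space)
  also have "\<dots> \<le> 1 / 4" using J by simp
  finally have "measure P ?C - measure ?Q ?C \<le> 1 / 4" .
  moreover have "measure P ?C = 1 - measure P B" by (simp add: P.prob_compl)
  moreover have "measure ?Q ?C = 1 - measure ?Q B"
    using Q.prob_compl[of B] by simp
  ultimately show ?thesis by simp
qed

lemma prob_space_error_law: "0 < \<sigma> \<Longrightarrow> prob_space (error_law n \<sigma>)"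
  unfolding error_law_def by (intro prob_space_PiM prob_space_normal_density)

lemma sets_error_law: "sets (error_law n \<sigma>) = sets (PiM {..<n} (\<lambda>_. borel))"
  unfolding error_law_def by (intro sets_PiM_cong) auto

lemma space_error_law: "space (error_law n \<sigma>) = extensional {..<n}"
  by (auto simp: error_law_def space_PiM PiE_def)

text \<open>In the symmetrised divergence the unknown normalising constant of the likelihood ratio cancels.\<close>

lemma error_law_mat_map_le:
  assumes inv: "mutually_inverse n M R" and s: "0 < \<sigma>"
    and J: "(\<integral>x. (\<Sum>i<n. ((mat_vec n R x i)\<^sup>2 - (x i)\<^sup>2) + ((mat_vec n M x i)\<^sup>2 - (x i)\<^sup>2)) \<partial>error_law n \<sigma>)
      \<le> \<sigma>\<^sup>2 / 8"
    and B: "B \<in> sets (error_law n \<sigma>)"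
  shows "measure (error_law n \<sigma>) {x \<in> space (error_law n \<sigma>). mat_map n R x \<in> B}
    \<le> measure (error_law n \<sigma>) B + 1 / 4"
proof -
  let ?P = "error_law n \<sigma>"
  define S where "S x = (\<Sum>i<n. (x i)\<^sup>2)" for x :: "nat \<Rightarrow> real"
  obtain c where c: "0 < c" and distr: "distr ?P ?P (mat_map n R) = density ?P
       (\<lambda>x. ennreal (c * exp (- (S (mat_map n M x) - S x) / (2 * \<sigma>\<^sup>2))))"
    using distr_error_law_mat_map[OF inv s] unfolding S_def by blast
  define L where "L x = c * exp (- (S (mat_map n M x) - S x) / (2 * \<sigma>\<^sup>2))" for x
  define q where "q x = ln c - (S (mat_map n M x) - S x) / (2 * \<sigma>\<^sup>2)" for x
  have distr: "distr ?P ?P (mat_map n R) = density ?P (\<lambda>x. ennreal (L x))"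
    using distr by (simp add: L_def)
  interpret P: prob_space ?P by (rule prob_space_error_law[OF s])
  have meas [measurable]: "mat_map n K \<in> measurable ?P ?P" for K
    using measurable_mat_map by (simp cong: measurable_cong_sets add: sets_error_law)
  have [measurable]: "(\<lambda>x. x i) \<in> borel_measurable ?P" if "i < n" for i
    using measurable_component_singleton[of i "{..<n}" "\<lambda>_. borel :: real measure"] that
    by (simp cong: measurable_cong_sets add: sets_error_law)
  have [measurable]: "S \<in> borel_measurable ?P" unfolding S_def by measurable
  have [measurable]: "L \<in> borel_measurable ?P" "q \<in> borel_measurable ?P"
    unfolding L_def q_def by measurable
  have pos: "0 < L x" for x using c by (simp add: L_def)
  have lnL: "ln (L x) = q x" for x using c by (simp add: L_def q_def ln_mult minus_divide_left)
  have Smap: "S (mat_map n K x) = (\<Sum>i<n. (mat_vec n K x i)\<^sup>2)" for K x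
    by (simp add: S_def mat_map_def)
  have iK: "integrable ?P (\<lambda>x. S (mat_map n K x))" for K
    unfolding Smap mat_vec_def power2_eq_square
    by (intro Bochner_Integration.integrable_sum
        integrable.intros[OF has_bochner_integral_error_law_linear_forms[OF s]])
  have iS: "integrable ?P S"
    unfolding S_def power2_eq_square
    by (intro Bochner_Integration.integrable_sum
        integrable.intros[OF has_bochner_integral_error_law_coords[OF s]]) auto
  have iq: "integrable ?P q"
    unfolding q_def by (intro Bochner_Integration.integrable_diff integrable_divide_zero iK iS) auto
  \<comment> \<open>\<open>M\<close> undoes \<open>R\<close>, so \<open>q\<close> at
    \<open>R x\<close> compares the norms of \<open>x\<close> and \<open>R x\<close>. Both are
    quadratic in \<open>x\<close>, and Gaussian second moments give integrability.\<close>
  have qR: "q (mat_map n R x) = ln c - (S x - S (mat_map n R x)) / (2 * \<sigma>\<^sup>2)" if "x \<in> space ?P" for x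
    using inv that by (auto simp: q_def mutually_inverse_def space_error_law)
  have iqR: "integrable ?P (\<lambda>x. q (mat_map n R x))"
  proof -
    have "integrable ?P (\<lambda>x. ln c - (S x - S (mat_map n R x)) / (2 * \<sigma>\<^sup>2))"
      by (intro Bochner_Integration.integrable_diff integrable_divide_zero iK iS) auto
    then show ?thesis using qR by (simp cong: Bochner_Integration.integrable_cong)
  qed
  \<comment> \<open>Weighting by \<open>L\<close> amounts to evaluating at \<open>R x\<close>, so
    integrability passes over through the image measure.\<close>
  have iLq: "integrable ?P (\<lambda>x. L x * q x)"
  proof -
    have "integrable (distr ?P ?P (mat_map n R)) q"
      using iqR by (subst integrable_distr_eq) auto
    then show ?thesis
      unfolding distr using pos by (subst (asm) integrable_density) (auto simp: less_imp_le)
  qed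
  have "(\<integral>x. L x * q x \<partial>?P) = (\<integral>x. q x \<partial>density ?P (\<lambda>x. ennreal (L x)))"
    using pos by (subst integral_density) (auto simp: less_imp_le)
  also have "\<dots> = (\<integral>x. q (mat_map n R x) \<partial>?P)"
    unfolding distr[symmetric] by (rule integral_distr) auto
  finally have Lq: "(\<integral>x. L x * q x \<partial>?P) = (\<integral>x. q (mat_map n R x) \<partial>?P)" .
  have "(\<integral>x. (L x - 1) * ln (L x) \<partial>?P) = (\<integral>x. L x * q x \<partial>?P) - (\<integral>x. q x \<partial>?P)"
    unfolding lnL using iLq iq by (simp add: left_diff_distrib)
  also have "\<dots> = (\<integral>x. q (mat_map n R x) - q x \<partial>?P)"
    unfolding Lq by (rule Bochner_Integration.integral_diff[symmetric, OF iqR iq])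
  also have "\<dots> = (\<integral>x. (\<Sum>i<n. ((mat_vec n R x i)\<^sup>2 - (x i)\<^sup>2) + ((mat_vec n M x i)\<^sup>2 - (x i)\<^sup>2)) / (2 * \<sigma>\<^sup>2) \<partial>?P)"
  proof (intro Bochner_Integration.integral_cong refl)
    fix x assume x: "x \<in> space ?P"
    have "q (mat_map n R x) - q x
        = ((S (mat_map n R x) - S x) + (S (mat_map n M x) - S x)) / (2 * \<sigma>\<^sup>2)"
      unfolding qR[OF x] unfolding q_def by (simp add: diff_divide_distrib add_divide_distrib)
    then show "q (mat_map n R x) - q x = (\<Sum>i<n. ((mat_vec n R x i)\<^sup>2 - (x i)\<^sup>2)
        + ((mat_vec n M x i)\<^sup>2 - (x i)\<^sup>2)) / (2 * \<sigma>\<^sup>2)"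
      unfolding Smap by (simp only: S_def sum.distrib sum_subtractf)
  qed
  \<comment> \<open>The assumed \<open>\<sigma>\<^sup>2 / 8\<close> is divided by
    \<open>2 * \<sigma>\<^sup>2\<close>.\<close>
  also have "\<dots> \<le> 1 / 16"
    using J s by (simp add: divide_le_eq)
  finally have J: "(\<integral>x. (L x - 1) * ln (L x) \<partial>?P) \<le> 1 / 16" .
  have "measure ?P {x \<in> space ?P. mat_map n R x \<in> B} = measure (distr ?P ?P (mat_map n R)) B"
    using B by (subst measure_distr) (auto simp: vimage_def Int_def conj_commute)
  also have "\<dots> \<le> measure ?P B + 1 / 4"
    unfolding distr
  proof (rule measure_density_le_jeffreys[OF P.prob_space_axioms _ pos _ _ J B])
    show "prob_space (density ?P (\<lambda>x. ennreal (L x)))"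
      unfolding distr[symmetric] by (rule P.prob_space_distr) simp
    show "integrable ?P (\<lambda>x. (L x - 1) * ln (L x))"
      unfolding lnL left_diff_distrib using iLq iq by simp
  qed simp
  finally show ?thesis .
qed

section \<open>The Frobenius norm\<close>

text \<open>A matrix is read as a vector indexed by pairs, so that the triangle and Cauchy-Schwarz
  inequalities for \<open>L2_set\<close> apply.\<close>

lemma frobenius_eq_L2_set: "frobenius n M = L2_set (\<lambda>(i, j). M i j) ({..<n} \<times> {..<n})"
  by (simp add: frobenius_def L2_set_def sum.cartesian_product case_prod_beta')

lemma frobenius_nonneg: "0 \<le> frobenius n M"
  by (simp add: frobenius_def sum_nonneg)

lemma frobenius_sq: "(frobenius n M)\<^sup>2 = (\<Sum>i<n. \<Sum>j<n. (M i j)\<^sup>2)"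
  by (simp add: frobenius_def sum_nonneg)

lemma frobenius_add_le: "frobenius n (\<lambda>i j. M i j + K i j) \<le> frobenius n M + frobenius n K"
  using L2_set_triangle_ineq[of "\<lambda>(i, j). M i j" "\<lambda>(i, j). K i j" "{..<n} \<times> {..<n}"]
  by (simp add: frobenius_eq_L2_set case_prod_beta')

lemma frobenius_scale: "frobenius n (\<lambda>i j. c * M i j) = \<bar>c\<bar> * frobenius n M"
  by (simp add: frobenius_def power_mult_distrib sum_distrib_left[symmetric] real_sqrt_mult)

text \<open>Cauchy-Schwarz bounds each squared entry by a squared row norm of \<open>M\<close> times
  a squared column norm of \<open>K\<close>, and the sum over all rows and columns
  factorises.\<close>

lemma frobenius_mult_le: "frobenius n (\<lambda>i j. \<Sum>k<n. M i k * K k j) \<le> frobenius n M * frobenius n K"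
proof (rule power2_le_imp_le)
  have "(frobenius n (\<lambda>i j. \<Sum>k<n. M i k * K k j))\<^sup>2
      \<le> (\<Sum>i<n. \<Sum>j<n. (\<Sum>k<n. (M i k)\<^sup>2) * (\<Sum>k<n. (K k j)\<^sup>2))"
    unfolding frobenius_sq by (intro sum_mono Cauchy_Schwarz_ineq_sum)
  also have "\<dots> = (\<Sum>i<n. \<Sum>k<n. (M i k)\<^sup>2) * (\<Sum>j<n. \<Sum>k<n. (K k j)\<^sup>2)"
    by (simp add: sum_product)
  also have "(\<Sum>j<n. \<Sum>k<n. (K k j)\<^sup>2) = (\<Sum>k<n. \<Sum>j<n. (K k j)\<^sup>2)"
    by (rule sum.swap)
  finally show "(frobenius n (\<lambda>i j. \<Sum>k<n. M i k * K k j))\<^sup>2 \<le> (frobenius n M * frobenius n K)\<^sup>2"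
    by (simp add: power_mult_distrib frobenius_sq)
qed (simp add: frobenius_nonneg)

text \<open>The trace of a product is the inner product of \<open>M\<close> with the transpose of
  \<open>K\<close>, and transposing keeps the Frobenius norm.\<close>

lemma trace_mult_le: "(\<Sum>i<n. \<Sum>k<n. M i k * K k i) \<le> frobenius n M * frobenius n K"
proof -
  have "(\<Sum>i<n. \<Sum>k<n. M i k * K k i) \<le> (\<Sum>p\<in>{..<n} \<times> {..<n}. \<bar>M (fst p) (snd p)\<bar> * \<bar>K (snd p) (fst p)\<bar>)"
    unfolding sum.cartesian_product
    by (intro sum_mono) (auto simp: case_prod_beta' abs_mult[symmetric])
  also have "\<dots> \<le> L2_set (\<lambda>p. M (fst p) (snd p)) ({..<n} \<times> {..<n})
      * L2_set (\<lambda>p. K (snd p) (fst p)) ({..<n} \<times> {..<n})"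
    by (rule L2_set_mult_ineq)
  also have "L2_set (\<lambda>p. K (snd p) (fst p)) ({..<n} \<times> {..<n}) = frobenius n K"
    unfolding L2_set_def frobenius_def
    by (subst sum.swap) (simp add: sum.cartesian_product case_prod_beta')
  finally show ?thesis by (simp add: frobenius_eq_L2_set case_prod_beta')
qed

lemma row_normalized_row_sum:
  assumes "network n A" "i < n"
  shows "(\<Sum>j<n. row_normalized n A i j) = 1"
  using assms by (auto simp: row_normalized_def network_def sum_divide_distrib[symmetric] degree_def)

text \<open>Each row sums to 1, so by Cauchy-Schwarz its squared norm is at least
  \<open>1 / n\<close>. This keeps the perturbation of \<open>\<beta>\<close> inside the parameter
  space.\<close>

lemma frobenius_row_normalized_ge_1:
  assumes net: "network n A" and n: "0 < n"
  shows "1 \<le> frobenius n (row_normalized n A)"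
proof -
  let ?G = "row_normalized n A"
  have row: "1 / real n \<le> (\<Sum>j<n. (?G i j)\<^sup>2)" if "i < n" for i
    using Cauchy_Schwarz_ineq_sum[of "\<lambda>_. 1" "?G i" "{..<n}"] row_normalized_row_sum[OF net that] n
    by (simp add: field_simps)
  have "1 = (\<Sum>i<n. 1 / real n)" using n by simp
  also have "\<dots> \<le> (\<Sum>i<n. \<Sum>j<n. (?G i j)\<^sup>2)"
    using row by (intro sum_mono) auto
  finally show ?thesis by (simp add: frobenius_def)
qed


section \<open>The resolvent of the network matrix\<close>

definition id_minus :: "real \<Rightarrow> (nat \<Rightarrow> nat \<Rightarrow> real) \<Rightarrow> nat \<Rightarrow> nat \<Rightarrow> real" where
  "id_minus b M i j = of_bool (i = j) - b * M i j"

lemma sum_of_bool_mult: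
  fixes i n :: nat
  shows "i < n \<Longrightarrow> (\<Sum>j<n. of_bool (i = j) * x j) = (x i :: real)"
  "i < n \<Longrightarrow> (\<Sum>j<n. x j * of_bool (j = i)) = (x i :: real)"
proof -
  assume i: "i < n"
  have "(\<Sum>j<n. of_bool (i = j) * x j) = (\<Sum>j<n. if i = j then x j else 0)"
    by (intro sum.cong) auto
  then show "(\<Sum>j<n. of_bool (i = j) * x j) = x i" using i by simp
next
  assume i: "i < n"
  have "(\<Sum>j<n. x j * of_bool (j = i)) = (\<Sum>j<n. if i = j then x j else 0)"
    by (intro sum.cong) auto
  then show "(\<Sum>j<n. x j * of_bool (j = i)) = x i" using i by simp
qed

lemma mat_vec_restrict [simp]: "mat_vec n M (restrict x {..<n}) = mat_vec n M x"
  by (auto simp: mat_vec_def)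

lemma mat_vec_mat_map [simp]: "mat_vec n M (mat_map n K x) = mat_vec n M (mat_vec n K x)"
  by (simp add: mat_map_def)

lemma mat_vec_mult: "mat_vec n M (mat_vec n K x) i = mat_vec n (\<lambda>i j. \<Sum>k<n. M i k * K k j) x i"
proof -
  have "mat_vec n M (mat_vec n K x) i = (\<Sum>k<n. \<Sum>j<n. M i k * K k j * x j)"
    by (simp add: mat_vec_def sum_distrib_left mult_ac)
  also have "\<dots> = (\<Sum>j<n. \<Sum>k<n. M i k * K k j * x j)"
    by (rule sum.swap)
  finally show ?thesis by (simp add: mat_vec_def sum_distrib_right)
qed

lemma mat_vec_id_minus:
  "i < n \<Longrightarrow> mat_vec n (id_minus b M) x i = x i - b * mat_vec n M x i"
  by (simp add: mat_vec_def id_minus_def left_diff_distrib sum_subtractf sum_of_bool_mult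
      sum_distrib_left mult.assoc)

lemma is_outcome_iff:
  "is_outcome n A (a, b, g, d) T e Y \<longleftrightarrow> Y \<in> extensional {..<n} \<and>
     (\<forall>i<n. mat_vec n (id_minus b (row_normalized n A)) Y i
        = a + g * T i + d * mat_vec n (row_normalized n A) T i + e i)"
  by (auto simp: is_outcome_def Let_def mat_vec_id_minus alpha_of_def beta_of_def gamma_of_def
      delta_of_def algebra_simps)

text \<open>Column \<open>j\<close> of \<open>R\<close> is the outcome with zero intercept, zero
  covariates and the \<open>j\<close>-th unit vector as error. Linearity makes \<open>R\<close> a
  right inverse, and uniqueness of outcomes makes it a left inverse.\<close>

lemma resolvent_exists:
  assumes net: "network n A" and b: "\<bar>b\<bar> < 1"
  obtains R where "mutually_inverse n (id_minus b (row_normalized n A)) R"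
proof
  let ?G = "row_normalized n A"
  let ?M = "id_minus b ?G"
  let ?\<theta> = "(0, b, 0, 0) :: param"
  define X where "X j = outcome n A ?\<theta> (\<lambda>_. 0) (\<lambda>i. of_bool (i = j))" for j
  define R where "R i j = X j i" for i j
  have \<theta>: "?\<theta> \<in> param_space" using b by (auto simp: param_space_def beta_of_def)
  have "is_outcome n A ?\<theta> (\<lambda>_. 0) (\<lambda>i. of_bool (i = j)) (X j)" for j
    unfolding X_def outcome_def by (rule theI'[OF ex1_is_outcome[OF net \<theta>]])
  then have X: "mat_vec n ?M (X j) i = of_bool (i = j)" if "i < n" for i j
    using that by (simp add: is_outcome_iff)
  have MR: "mat_vec n ?M (mat_vec n R x) i = x i" if "i < n" for x i
  proof -
    have "mat_vec n ?M (mat_vec n R x) i = (\<Sum>j<n. mat_vec n ?M (X j) i * x j)"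
      unfolding mat_vec_mult by (simp add: mat_vec_def R_def)
    then show ?thesis using that by (simp add: X sum_of_bool_mult)
  qed
  show "mutually_inverse n ?M R"
    unfolding mutually_inverse_def
  proof (intro ballI conjI)
    fix x :: "nat \<Rightarrow> real" assume x: "x \<in> extensional {..<n}"
    show "mat_map n ?M (mat_map n R x) = x"
      using x by (intro extensionalityI[of _ "{..<n}"]) (auto simp: mat_map_def MR)
    show "mat_map n R (mat_map n ?M x) = x"
    \<comment> \<open>Both vectors are outcomes for the error \<open>mat_vec n ?M x\<close>.\<close>
    proof (rule is_outcome_unique[OF net \<theta>])
      show "is_outcome n A ?\<theta> (\<lambda>_. 0) (mat_vec n ?M x) (mat_map n R (mat_map n ?M x))"
        by (simp add: is_outcome_iff MR) (simp add: mat_map_def)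
      show "is_outcome n A ?\<theta> (\<lambda>_. 0) (mat_vec n ?M x) x"
        using x by (simp add: is_outcome_iff)
    qed
  qed
qed

text \<open>The identity \<open>(I - b G) R = I\<close>, applied to the \<open>j\<close>-th unit
  vector and solved for \<open>R i j\<close>.\<close>

lemma resolvent_entry:
  assumes inv: "mutually_inverse n (id_minus b G) R" and i: "i < n" and j: "j < n"
  shows "R i j = of_bool (i = j) + b * (\<Sum>k<n. G i k * R k j)"
proof -
  let ?x = "\<lambda>k\<in>{..<n}. of_bool (k = j) :: real"
  have R: "mat_vec n R ?x = (\<lambda>i. R i j)"
    using j by (simp add: mat_vec_def sum_of_bool_mult fun_eq_iff)
  have "mat_map n (id_minus b G) (mat_map n R ?x) i = ?x i"
    using inv by (simp add: mutually_inverse_def)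
  then have "mat_vec n (id_minus b G) (mat_vec n R ?x) i = ?x i"
    using i by (simp add: mat_map_def)
  then have "R i j - b * mat_vec n G (\<lambda>i. R i j) i = of_bool (i = j)"
    unfolding R mat_vec_id_minus[OF i] using i by simp
  then show ?thesis unfolding mat_vec_def by linarith
qed

text \<open>Write \<open>R = I + b H\<close> and \<open>H = G + b K\<close>. The first-order terms
  \<open>2 b x.Hx\<close> and \<open>- 2 b x.Gx\<close> of the two differences combine to
  \<open>2 b\<^sup>2 x.Kx\<close>, so the total is of second order in \<open>b\<close>.\<close>

lemma resolvent_jeffreys_le:
  assumes inv: "mutually_inverse n (id_minus b G) R" and s: "0 < \<sigma>"
    and b: "\<bar>b\<bar> * frobenius n G \<le> 1 / 8"
  shows "(\<integral>x. (\<Sum>i<n. ((mat_vec n R x i)\<^sup>2 - (x i)\<^sup>2) + ((mat_vec n (id_minus b G) x i)\<^sup>2 - (x i)\<^sup>2))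
      \<partial>error_law n \<sigma>) \<le> \<sigma>\<^sup>2 / 8"
proof -
  define H where "H i j = (\<Sum>k<n. G i k * R k j)" for i j
  define K where "K i j = (\<Sum>k<n. G i k * H k j)" for i j
  have R: "R i j = of_bool (i = j) + b * H i j" if "i < n" "j < n" for i j
    unfolding H_def by (rule resolvent_entry[OF inv that])
  have H: "H i j = G i j + b * K i j" if "i < n" "j < n" for i j
  proof -
    have "H i j = (\<Sum>k<n. G i k * (of_bool (k = j) + b * H k j))"
      unfolding H_def[of i j] using that by (intro sum.cong) (auto simp: R)
    then show ?thesis using that
      by (simp add: distrib_left sum.distrib sum_of_bool_mult K_def sum_distrib_left mult_ac)
  qed
  have Rx: "mat_vec n R x i = x i + b * mat_vec n H x i" if "i < n" for x i
  proof -
    have "mat_vec n R x i = (\<Sum>j<n. of_bool (i = j) * x j + b * (H i j * x j))"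
      unfolding mat_vec_def using that by (intro sum.cong) (auto simp: R distrib_right)
    then show ?thesis
      using that by (simp add: mat_vec_def sum.distrib sum_of_bool_mult sum_distrib_left)
  qed
  have Hx: "mat_vec n H x i = mat_vec n G x i + b * mat_vec n K x i" if "i < n" for x i
  proof -
    have "mat_vec n H x i = (\<Sum>j<n. G i j * x j + b * (K i j * x j))"
      unfolding mat_vec_def using that by (intro sum.cong) (auto simp: H distrib_right)
    then show ?thesis
      by (simp add: mat_vec_def sum.distrib sum_distrib_left)
  qed
  \<comment> \<open>\<open>x i\<close> is spelled as a sum against \<open>of_bool (i = j)\<close> so
    that every term is a product of two linear forms, as the moment formula expects.\<close>
  have quad: "((mat_vec n R x i)\<^sup>2 - (x i)\<^sup>2) + ((mat_vec n (id_minus b G) x i)\<^sup>2 - (x i)\<^sup>2)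
    = b\<^sup>2 * ((mat_vec n G x i * mat_vec n G x i + mat_vec n H x i * mat_vec n H x i)
        + 2 * ((\<Sum>j<n. of_bool (i = j) * x j) * mat_vec n K x i))"
    if "i < n" for x i
  proof -
    have "b * mat_vec n H x i = b * mat_vec n G x i + b * b * mat_vec n K x i"
      using Hx[OF that, of x] by (simp add: distrib_left)
    then have "x i * (b * mat_vec n H x i) = x i * (b * mat_vec n G x i + b * b * mat_vec n K x i)"
      by simp
    then show ?thesis
      unfolding Rx[OF that] mat_vec_id_minus[OF that] sum_of_bool_mult(1)[OF that]
      by (simp add: power2_eq_square algebra_simps)
  qed
  have "(\<integral>x. (\<Sum>i<n. ((mat_vec n R x i)\<^sup>2 - (x i)\<^sup>2) + ((mat_vec n (id_minus b G) x i)\<^sup>2 - (x i)\<^sup>2))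
      \<partial>error_law n \<sigma>)
    = (\<integral>x. (\<Sum>i<n. b\<^sup>2 * ((mat_vec n G x i * mat_vec n G x i + mat_vec n H x i * mat_vec n H x i)
        + 2 * ((\<Sum>j<n. of_bool (i = j) * x j) * mat_vec n K x i))) \<partial>error_law n \<sigma>)"
    by (intro Bochner_Integration.integral_cong refl sum.cong quad) auto
  also have "\<dots> = (\<Sum>i<n. b\<^sup>2 * ((\<sigma>\<^sup>2 * (\<Sum>j<n. G i j * G i j) + \<sigma>\<^sup>2 * (\<Sum>j<n. H i j * H i j))
      + 2 * (\<sigma>\<^sup>2 * (\<Sum>j<n. of_bool (i = j) * K i j))))"
    unfolding mat_vec_def
    by (intro has_bochner_integral_integral_eq has_bochner_integral_sum has_bochner_integral_add
        has_bochner_integral_mult_right has_bochner_integral_error_law_linear_forms[OF s])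
  also have "\<dots> = b\<^sup>2 * \<sigma>\<^sup>2 * ((\<Sum>i<n. \<Sum>j<n. (G i j)\<^sup>2) + (\<Sum>i<n. \<Sum>j<n. (H i j)\<^sup>2) + 2 * (\<Sum>i<n. K i i))"
    by (simp add: sum_of_bool_mult power2_eq_square sum.distrib sum_distrib_left distrib_left mult_ac)
  \<comment> \<open>\<open>K\<close> is the product of \<open>G\<close> and \<open>H\<close>, so its
    trace is at most the product of their norms, which completes the square.\<close>
  also have "\<dots> \<le> b\<^sup>2 * \<sigma>\<^sup>2 * ((frobenius n G)\<^sup>2 + (frobenius n H)\<^sup>2 + 2 * (frobenius n G * frobenius n H))"
    unfolding frobenius_sq[symmetric] K_def
    by (intro mult_left_mono add_left_mono trace_mult_le) auto
  also have "\<dots> = \<sigma>\<^sup>2 * (\<bar>b\<bar> * frobenius n G + \<bar>b\<bar> * frobenius n H)\<^sup>2"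
    by (simp add: power2_eq_square algebra_simps flip: abs_mult)
  \<comment> \<open>The \<open>G\<close> term is at most \<open>1 / 8\<close> by assumption, the
    \<open>H\<close> term at most \<open>1 / 7\<close>; the squared sum stays below
    \<open>1 / 8\<close>.\<close>
  also have "\<dots> \<le> \<sigma>\<^sup>2 * (1 / 8 + 1 / 7)\<^sup>2"
  proof (intro mult_left_mono power_mono add_mono b)
    \<comment> \<open>From \<open>H = G + b G H\<close>, the quantity
      \<open>h = \<bar>b\<bar> * frobenius n H\<close> satisfies
      \<open>h \<le> 1 / 8 + h / 8\<close>, whence \<open>h \<le> 1 / 7\<close>.\<close>
    have "frobenius n H = frobenius n (\<lambda>i j. G i j + b * K i j)"
      by (simp add: frobenius_def H)
    also have "\<dots> \<le> frobenius n G + \<bar>b\<bar> * frobenius n K"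
      using frobenius_add_le[of n G "\<lambda>i j. b * K i j"] by (simp add: frobenius_scale)
    also have "\<dots> \<le> frobenius n G + \<bar>b\<bar> * (frobenius n G * frobenius n H)"
      unfolding K_def by (intro add_left_mono mult_left_mono frobenius_mult_le) auto
    finally have "\<bar>b\<bar> * frobenius n H
        \<le> \<bar>b\<bar> * (frobenius n G + \<bar>b\<bar> * (frobenius n G * frobenius n H))"
      by (rule mult_left_mono) simp
    also have "\<dots> = \<bar>b\<bar> * frobenius n G + (\<bar>b\<bar> * frobenius n G) * (\<bar>b\<bar> * frobenius n H)"
      by (simp add: algebra_simps)
    also have "\<dots> \<le> 1 / 8 + 1 / 8 * (\<bar>b\<bar> * frobenius n H)"
      using b by (intro add_mono mult_right_mono) (auto simp: frobenius_nonneg)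
    finally show "\<bar>b\<bar> * frobenius n H \<le> 1 / 7" by simp
  qed (auto simp: frobenius_nonneg)
  also have "\<dots> \<le> \<sigma>\<^sup>2 / 8"
    by (simp add: power2_eq_square)
  finally show ?thesis .
qed

section \<open>Data laws along the matched parameters\<close>

definition matched_param :: "real \<Rightarrow> param" where
  "matched_param b = (1 - b, b, 1, - b)"

lemma matched_param_in_param_space: "\<bar>b\<bar> < 1 \<Longrightarrow> matched_param b \<in> param_space"
  by (auto simp: matched_param_def param_space_def beta_of_def)

text \<open>By uniqueness it suffices to check the model equation. As \<open>G\<close> fixes the
  all-ones vector, \<open>I - b G\<close> maps \<open>1 + T\<close> to
  \<open>(1 - b) + T - b G T\<close>, and it maps \<open>R e\<close> to \<open>e\<close>.\<close>

lemma outcome_matched_param: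
  assumes net: "network n A" and b: "\<bar>b\<bar> < 1"
    and inv: "mutually_inverse n (id_minus b (row_normalized n A)) R"
  shows "outcome n A (matched_param b) T e = (\<lambda>i\<in>{..<n}. 1 + T i + mat_vec n R e i)"
  unfolding outcome_def
proof (rule the1_equality)
  show "\<exists>!Y. is_outcome n A (matched_param b) T e Y"
    by (rule ex1_is_outcome[OF net matched_param_in_param_space[OF b]])
  let ?G = "row_normalized n A" and ?Y = "\<lambda>i\<in>{..<n}. 1 + T i + mat_vec n R e i"
  show "is_outcome n A (matched_param b) T e ?Y"
    unfolding matched_param_def is_outcome_iff
  proof (intro conjI allI impI)
    fix i assume i: "i < n"
    have "mat_map n (id_minus b ?G) (mat_map n R (restrict e {..<n})) i = e i"
      using inv i by (simp add: mutually_inverse_def)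
    then have R: "mat_vec n R e i - b * mat_vec n ?G (mat_vec n R e) i = e i"
      using i by (simp add: mat_map_def mat_vec_id_minus)
    have "mat_vec n ?G (\<lambda>i. 1 + T i + mat_vec n R e i) i
        = 1 + mat_vec n ?G T i + mat_vec n ?G (mat_vec n R e) i"
      using row_normalized_row_sum[OF net i]
      by (simp add: mat_vec_def[of n ?G] distrib_left sum.distrib)
    then show "mat_vec n (id_minus b ?G) ?Y i = 1 - b + 1 * T i + - b * mat_vec n ?G T i + e i"
      using i R by (simp add: mat_vec_id_minus algebra_simps)
  qed simp
qed

text \<open>Fubini: an event is measured by its sections at fixed \<open>T\<close>, which reduces
  comparisons of data laws to comparisons of error laws.\<close>

lemma emeasure_data_law:
  assumes net: "network n A" and \<theta>: "\<theta> \<in> param_space" and \<mu>: "real_distribution \<mu>" and s: "0 < \<sigma>"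
    and B: "B \<in> sets (data_space n)"
  shows "(\<lambda>T. emeasure (error_law n \<sigma>) {e \<in> space (error_law n \<sigma>). (T, outcome n A \<theta> T e) \<in> B})
      \<in> borel_measurable (covariate_law n \<mu>)" (is "?f \<in> _")
    and "emeasure (data_law n A \<mu> \<sigma> \<theta>) B = (\<integral>\<^sup>+T. emeasure (error_law n \<sigma>)
      {e \<in> space (error_law n \<sigma>). (T, outcome n A \<theta> T e) \<in> B} \<partial>covariate_law n \<mu>)"
    and "T \<in> space (covariate_law n \<mu>) \<Longrightarrow>
      {e \<in> space (error_law n \<sigma>). (T, outcome n A \<theta> T e) \<in> B} \<in> sets (error_law n \<sigma>)"
proof -
  interpret e: prob_space "error_law n \<sigma>" by (rule prob_space_error_law[OF s])
  let ?N = "covariate_law n \<mu>" and ?P = "error_law n \<sigma>"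
  let ?F = "\<lambda>(T, e). (T, outcome n A \<theta> T e)"
  let ?V = "?F -` B \<inter> space (?N \<Otimes>\<^sub>M ?P)"
  have F: "?F \<in> measurable (?N \<Otimes>\<^sub>M ?P) (data_space n)"
    using \<mu> by (intro measurable_outcome[OF net \<theta>]) (simp add: real_distribution_def real_distribution_axioms_def)
  have V: "?V \<in> sets (?N \<Otimes>\<^sub>M ?P)" by (rule measurable_sets[OF F B])
  have sec: "Pair T -` ?V = {e \<in> space ?P. (T, outcome n A \<theta> T e) \<in> B}" if "T \<in> space ?N" for T
    using that by (auto simp: space_pair_measure)
  show "?f \<in> borel_measurable ?N"
    using e.measurable_emeasure_Pair[OF V]
    by (rule measurable_cong[THEN iffD1, rotated]) (simp only: sec)
  have "emeasure (data_law n A \<mu> \<sigma> \<theta>) B = (\<integral>\<^sup>+T. emeasure ?P (Pair T -` ?V) \<partial>?N)"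
    unfolding data_law_def emeasure_distr[OF F B] by (rule e.emeasure_pair_measure_alt[OF V])
  also have "\<dots> = (\<integral>\<^sup>+T. ?f T \<partial>?N)"
    by (intro nn_integral_cong) (simp only: sec)
  finally show "emeasure (data_law n A \<mu> \<sigma> \<theta>) B = (\<integral>\<^sup>+T. ?f T \<partial>?N)" .
  show "{e \<in> space ?P. (T, outcome n A \<theta> T e) \<in> B} \<in> sets ?P" if "T \<in> space ?N"
    using sets_Pair1[OF V, of T] by (simp only: sec[OF that])
qed

lemma sets_data_law: "sets (data_law n A \<mu> \<sigma> \<theta>) = sets (data_space n)"
  by (simp add: data_law_def)

text \<open>At fixed \<open>T\<close> the outcomes are \<open>1 + T + R e\<close> and
  \<open>1 + T + e\<close>, so the section for \<open>b\<close> is the preimage under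
  \<open>R\<close> of the section for 0. The error laws compare with the same slack
  \<open>1 / 4\<close> for every \<open>T\<close>, which survives integration.\<close>

lemma data_law_matched_param_le:
  assumes net: "network n A" and \<mu>: "real_distribution \<mu>" and s: "0 < \<sigma>"
    and b: "\<bar>b\<bar> < 1" "\<bar>b\<bar> * frobenius n (row_normalized n A) \<le> 1 / 8"
    and B: "B \<in> sets (data_space n)"
  shows "measure (data_law n A \<mu> \<sigma> (matched_param b)) B
    \<le> measure (data_law n A \<mu> \<sigma> (matched_param 0)) B + 1 / 4"
proof -
  let ?N = "covariate_law n \<mu>" and ?P = "error_law n \<sigma>" and ?G = "row_normalized n A"
  let ?D = "\<lambda>b. data_law n A \<mu> \<sigma> (matched_param b)"
  let ?S = "\<lambda>b T. {e \<in> space ?P. (T, outcome n A (matched_param b) T e) \<in> B}"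
  interpret \<mu>: real_distribution \<mu> by fact
  interpret T: prob_space ?N
    unfolding covariate_law_def by (intro prob_space_PiM \<mu>.prob_space_axioms)
  interpret e: prob_space ?P by (rule prob_space_error_law[OF s])
  have \<theta>: "matched_param b \<in> param_space" "matched_param 0 \<in> param_space"
    using b by (auto intro: matched_param_in_param_space)
  interpret Db: prob_space "?D b" by (rule prob_space_data_law[OF net \<theta>(1) \<mu> s])
  interpret D0: prob_space "?D 0" by (rule prob_space_data_law[OF net \<theta>(2) \<mu> s])
  obtain R where R: "mutually_inverse n (id_minus b ?G) R"
    by (rule resolvent_exists[OF net b(1)])
  obtain R0 where R0: "mutually_inverse n (id_minus 0 ?G) R0"
    by (rule resolvent_exists[OF net, of 0]) auto
  \<comment> \<open>At \<open>b = 0\<close> the resolvent is the identity.\<close>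
  have R0e: "mat_vec n R0 e i = e i" if "i < n" for e i
    using resolvent_entry[OF R0] that by (simp add: mat_vec_def sum_of_bool_mult)
  have S0: "?S 0 T = {e \<in> space ?P. (T, \<lambda>i\<in>{..<n}. 1 + T i + e i) \<in> B}" for T
    by (simp add: outcome_matched_param[OF net _ R0] R0e cong: restrict_cong)
  have Sb: "?S b T = {e \<in> space ?P. mat_map n R e \<in> ?S 0 T}" for T
    unfolding S0
    by (auto simp: outcome_matched_param[OF net b(1) R] mat_map_def space_error_law cong: restrict_cong)
  have le: "emeasure ?P (?S b T) \<le> emeasure ?P (?S 0 T) + ennreal (1 / 4)" if "T \<in> space ?N" for T
  proof -
    have "measure ?P (?S b T) \<le> measure ?P (?S 0 T) + 1 / 4"
      unfolding Sb
      by (rule error_law_mat_map_le[OF R s resolvent_jeffreys_le[OF R s b(2)]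
            emeasure_data_law(3)[OF net \<theta>(2) \<mu> s B that]])
    then show ?thesis
      by (simp add: e.emeasure_eq_measure ennreal_plus[symmetric] del: ennreal_plus)
  qed
  have "emeasure (?D b) B = (\<integral>\<^sup>+T. emeasure ?P (?S b T) \<partial>?N)"
    by (rule emeasure_data_law(2)[OF net \<theta>(1) \<mu> s B])
  also have "\<dots> \<le> (\<integral>\<^sup>+T. emeasure ?P (?S 0 T) + ennreal (1 / 4) \<partial>?N)"
    by (intro nn_integral_mono le)
  also have "\<dots> = (\<integral>\<^sup>+T. emeasure ?P (?S 0 T) \<partial>?N) + (\<integral>\<^sup>+T. ennreal (1 / 4) \<partial>?N)"
    by (intro nn_integral_add emeasure_data_law(1)[OF net \<theta>(2) \<mu> s B]) simp
  also have "\<dots> = emeasure (?D 0) B + ennreal (1 / 4)"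
    by (simp only: emeasure_data_law(2)[OF net \<theta>(2) \<mu> s B] nn_integral_const T.emeasure_space_1 mult_1_right)
  finally show ?thesis
    by (simp add: Db.emeasure_eq_measure D0.emeasure_eq_measure ennreal_plus[symmetric] del: ennreal_plus)
qed

section \<open>Two-point bounds and the minimax theorem\<close>

text \<open>\<open>P\<close> need not be one of the two hypotheses: it serves as a common reference.\<close>

lemma two_point_lower_bound:
  fixes f :: "'a \<Rightarrow> real"
  assumes "prob_space P" "prob_space Q1" "prob_space Q2"
    and sets: "sets Q1 = sets P" "sets Q2 = sets P"
    and le: "\<And>B. B \<in> sets P \<Longrightarrow> measure Q1 B \<le> measure P B + 1 / 4"
      "\<And>B. B \<in> sets P \<Longrightarrow> measure Q2 B \<le> measure P B + 1 / 4"
    and [measurable]: "f \<in> borel_measurable P"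
    and sep: "2 * s \<le> \<bar>u - v\<bar>"
  shows "1 / 4 \<le> \<P>(x in Q1. s \<le> \<bar>f x - u\<bar>) \<or> 1 / 4 \<le> \<P>(x in Q2. s \<le> \<bar>f x - v\<bar>)"
proof -
  interpret P: prob_space P by fact
  interpret Q1: prob_space Q1 by fact
  interpret Q2: prob_space Q2 by fact
  have space: "space Q1 = space P" "space Q2 = space P"
    using sets[THEN sets_eq_imp_space_eq] by auto
  let ?B = "\<lambda>c. {x \<in> space P. \<bar>f x - c\<bar> < s}"
  have B: "?B c \<in> sets P" for c by measurable
  have compl: "{x \<in> space P. s \<le> \<bar>f x - c\<bar>} = space P - ?B c" for c by auto
  \<comment> \<open>No value of \<open>f\<close> is less than \<open>s\<close> away from both
    \<open>u\<close> and \<open>v\<close>, so the two sets are disjoint.\<close>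
  have "measure P (?B u) + measure P (?B v) = measure P (?B u \<union> ?B v)"
    using sep by (intro P.finite_measure_Union[symmetric] B) auto
  also have "\<dots> \<le> 1" by (rule P.prob_le_1)
  \<comment> \<open>The two slacks add \<open>1 / 2\<close>. Hence the complements have total mass
    at least \<open>1 / 2\<close>, and one of them at least \<open>1 / 4\<close>.\<close>
  finally have "measure Q1 (?B u) + measure Q2 (?B v) \<le> 3 / 2"
    using le(1)[OF B, of u] le(2)[OF B, of v] by simp
  moreover have "measure Q1 (space P - ?B u) = 1 - measure Q1 (?B u)"
    "measure Q2 (space P - ?B v) = 1 - measure Q2 (?B v)"
    using Q1.prob_compl[of "?B u"] Q2.prob_compl[of "?B v"] B sets by (auto simp: space)
  ultimately show ?thesis
    unfolding space compl by linarith
qed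

lemma measurable_estimator_components:
  assumes "est \<in> estimators n"
  shows "(\<lambda>x. alpha_of (est x)) \<in> borel_measurable (data_space n)"
    "(\<lambda>x. beta_of (est x)) \<in> borel_measurable (data_space n)"
    "(\<lambda>x. delta_of (est x)) \<in> borel_measurable (data_space n)"
  using assms unfolding estimators_def alpha_of_def beta_of_def delta_of_def
  by (auto elim!: measurable_compose intro!: borel_measurable_continuous_onI continuous_intros)

text \<open>The common reference is the law at \<open>matched_param 0\<close>, so \<open>b\<close>
  and \<open>- b\<close> can be compared without a direct bound between their laws. The targets
  \<open>u\<close> and \<open>v\<close> are free, to serve every component of the parameter.\<close>

lemma matched_param_two_point:
  fixes f :: "_ \<Rightarrow> real"
  assumes net: "network n A" and \<mu>: "real_distribution \<mu>" and s: "0 < \<sigma>" and n: "0 < n"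
    and b: "\<bar>b\<bar> * frobenius n (row_normalized n A) \<le> 1 / 8"
      "\<bar>b'\<bar> * frobenius n (row_normalized n A) \<le> 1 / 8"
    and f: "f \<in> borel_measurable (data_space n)"
    and sep: "2 * r \<le> \<bar>u - v\<bar>"
  shows "1 / 4 \<le> \<P>(x in data_law n A \<mu> \<sigma> (matched_param b). r \<le> \<bar>f x - u\<bar>)
    \<or> 1 / 4 \<le> \<P>(x in data_law n A \<mu> \<sigma> (matched_param b'). r \<le> \<bar>f x - v\<bar>)"
proof -
  let ?D = "\<lambda>b. data_law n A \<mu> \<sigma> (matched_param b)"
  \<comment> \<open>The norm is at least 1, so \<open>\<bar>c\<bar> \<le> 1 / 8\<close>.\<close>
  have lt: "\<bar>c\<bar> < 1" if "\<bar>c\<bar> * frobenius n (row_normalized n A) \<le> 1 / 8" for c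
    using frobenius_row_normalized_ge_1[OF net n] that
      mult_left_mono[of 1 "frobenius n (row_normalized n A)" "\<bar>c\<bar>"] by simp
  have ps: "prob_space (?D c)" if "\<bar>c\<bar> * frobenius n (row_normalized n A) \<le> 1 / 8" for c
    by (rule prob_space_data_law[OF net matched_param_in_param_space[OF lt[OF that]] \<mu> s])
  show ?thesis
  proof (rule two_point_lower_bound[of "?D 0" "?D b" "?D b'" f r u v])
    show "f \<in> borel_measurable (?D 0)"
      using f by (simp cong: measurable_cong_sets add: sets_data_law)
    show "measure (?D b) B \<le> measure (?D 0) B + 1 / 4" "measure (?D b') B \<le> measure (?D 0) B + 1 / 4"
      if "B \<in> sets (?D 0)" for B
      using that b by (auto simp: sets_data_law intro!: data_law_matched_param_le[OF net \<mu> s] lt)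
    show "prob_space (?D 0)" "prob_space (?D b)" "prob_space (?D b')"
      using b by (simp_all add: ps)
  qed (simp_all add: sets_data_law sep)
qed

theorem theorem2:
  fixes \<mu> :: "real measure" and \<sigma> \<tau> :: real
  assumes "0 < \<sigma>"
    and "real_distribution \<mu>"
    and "integrable \<mu> (\<lambda>t. t)"
    and "(LINT t|\<mu>. t) = \<tau>"
  shows "\<exists>N::nat.
    (\<exists>c\<^sub>\<beta>>0. \<exists>c\<^sub>\<delta>>0. \<exists>c\<^sub>0>0. \<forall>n>N. \<forall>A. network n A \<longrightarrow>
       (INF est\<in>estimators n. SUP \<theta>\<in>param_space.
          min (\<P>(x in data_law n A \<mu> \<sigma> \<theta>.
                 \<bar>beta_of (est x) - beta_of \<theta>\<bar> \<ge> c\<^sub>\<beta> / frobenius n (row_normalized n A)))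
              (\<P>(x in data_law n A \<mu> \<sigma> \<theta>.
                 \<bar>delta_of (est x) - delta_of \<theta>\<bar> \<ge> c\<^sub>\<delta> / frobenius n (row_normalized n A))))
       \<ge> c\<^sub>0) \<and>
    (\<tau> \<noteq> 0 \<longrightarrow>
      (\<exists>c\<^sub>\<alpha>>0. \<exists>c\<^sub>\<alpha>'>0. \<forall>n>N. \<forall>A. network n A \<longrightarrow>
         (INF est\<in>estimators n. SUP \<theta>\<in>param_space.
            \<P>(x in data_law n A \<mu> \<sigma> \<theta>.
               \<bar>alpha_of (est x) - alpha_of \<theta>\<bar> \<ge> c\<^sub>\<alpha> / frobenius n (row_normalized n A)))
         \<ge> c\<^sub>\<alpha>'))"
proof -
  \<comment> \<open>The lower-bound rule for infima of reals asks for a nonempty family.\<close>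
  have "(\<lambda>_. 0) \<in> estimators n" for n
    unfolding estimators_def by (rule borel_measurable_const)
  then have nonempty: "estimators n \<noteq> {}" for n by blast
  \<comment> \<open>It suffices to find one bad parameter for each estimator. The bound by 1 makes
    each supremum an upper bound of its family.\<close>
  have inf_sup: "1 / 4 \<le> (INF est\<in>estimators n. SUP \<theta>\<in>param_space. g est \<theta>)"
    if le: "\<And>est \<theta>. \<theta> \<in> param_space \<Longrightarrow> g est \<theta> \<le> 1"
      and ex: "\<And>est. est \<in> estimators n \<Longrightarrow> \<exists>\<theta>\<in>param_space. 1 / 4 \<le> g est \<theta>"
    for n and g :: "_ \<Rightarrow> param \<Rightarrow> real"
  proof (rule cINF_greatest[OF nonempty])
    fix est assume "est \<in> estimators n"
    then obtain \<theta> where "\<theta> \<in> param_space" "1 / 4 \<le> g est \<theta>" using ex by blast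
    then show "1 / 4 \<le> (SUP \<theta>\<in>param_space. g est \<theta>)"
      by (intro cSUP_upper2[of _ _ \<theta>] bdd_aboveI2[of _ _ 1] le)
  qed
  have components: "alpha_of (matched_param b) = 1 - b" "beta_of (matched_param b) = b"
    "delta_of (matched_param b) = - b" for b
    by (simp_all add: matched_param_def alpha_of_def beta_of_def delta_of_def)
  have main:
    "(INF est\<in>estimators n. SUP \<theta>\<in>param_space.
        min (\<P>(x in data_law n A \<mu> \<sigma> \<theta>. \<bar>beta_of (est x) - beta_of \<theta>\<bar> \<ge> 1 / 16 / frobenius n (row_normalized n A)))
            (\<P>(x in data_law n A \<mu> \<sigma> \<theta>. \<bar>delta_of (est x) - delta_of \<theta>\<bar> \<ge> 1 / 16 / frobenius n (row_normalized n A))))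
      \<ge> 1 / 4"
    "(INF est\<in>estimators n. SUP \<theta>\<in>param_space.
        \<P>(x in data_law n A \<mu> \<sigma> \<theta>. \<bar>alpha_of (est x) - alpha_of \<theta>\<bar> \<ge> 1 / 16 / frobenius n (row_normalized n A)))
      \<ge> 1 / 4"
    if n: "0 < n" and net: "network n A" for n A
  proof -
    let ?F = "frobenius n (row_normalized n A)"
    let ?D = "data_law n A \<mu> \<sigma>"
    \<comment> \<open>The largest radius the comparison allows. Distinct points of
      \<open>{0, b, -b}\<close> are at least \<open>b\<close> apart, twice the threshold
      \<open>1 / 16 / ?F\<close>.\<close>
    define b where "b = 1 / (8 * ?F)"
    have F: "1 \<le> ?F" by (rule frobenius_row_normalized_ge_1[OF net n])
    have b: "0 < b" "b < 1" "b * ?F = 1 / 8" "2 * (1 / 16 / ?F) = b"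
      using F by (auto simp: b_def field_simps)
    have in_space: "matched_param b \<in> param_space" "matched_param (- b) \<in> param_space"
      "matched_param 0 \<in> param_space"
      using b by (auto intro: matched_param_in_param_space)
    have prob_le: "measure (?D \<theta>) X \<le> 1" if "\<theta> \<in> param_space" for \<theta> X
      using prob_space_data_law[OF net that assms(2,1)] by (rule prob_space.prob_le_1)
    note tp = matched_param_two_point[OF net assms(2,1) n]
    show "(INF est\<in>estimators n. SUP \<theta>\<in>param_space.
        min (\<P>(x in ?D \<theta>. \<bar>beta_of (est x) - beta_of \<theta>\<bar> \<ge> 1 / 16 / ?F))
            (\<P>(x in ?D \<theta>. \<bar>delta_of (est x) - delta_of \<theta>\<bar> \<ge> 1 / 16 / ?F))) \<ge> 1 / 4"
    proof (rule inf_sup)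
      fix est assume est: "est \<in> estimators n"
      let ?B = "\<lambda>c. 1 / 4 \<le> \<P>(x in ?D (matched_param c). 1 / 16 / ?F \<le> \<bar>beta_of (est x) - c\<bar>)"
      \<comment> \<open>The target is \<open>- c\<close>, the last component of
        \<open>matched_param c\<close>.\<close>
      let ?C = "\<lambda>c. 1 / 4 \<le> \<P>(x in ?D (matched_param c). 1 / 16 / ?F \<le> \<bar>delta_of (est x) - - c\<bar>)"
      note m = measurable_estimator_components[OF est]
      have BC: "?B c \<or> ?B d" "?C c \<or> ?C d"
        if cd: "c \<in> {0, b, -b}" "d \<in> {0, b, -b}" "c \<noteq> d" for c d
      proof -
        have sep: "2 * (1 / 16 / ?F) \<le> \<bar>c - d\<bar>" "2 * (1 / 16 / ?F) \<le> \<bar>- c - - d\<bar>"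
          unfolding b(4) using cd b(1) by auto
        have small: "\<bar>c\<bar> * ?F \<le> 1 / 8" "\<bar>d\<bar> * ?F \<le> 1 / 8"
          using cd b(1,3) by auto
        show "?B c \<or> ?B d" by (rule tp[OF small m(2) sep(1)])
        show "?C c \<or> ?C d" by (rule tp[OF small m(3) sep(2)])
      qed
      have "?B 0 \<or> ?B b" "?B 0 \<or> ?B (-b)" "?B b \<or> ?B (-b)"
        "?C 0 \<or> ?C b" "?C 0 \<or> ?C (-b)" "?C b \<or> ?C (-b)"
        by (rule BC; use b(1) in simp)+
      \<comment> \<open>\<open>?B\<close> fails at no more than one of the three points, and so does
        \<open>?C\<close>; by pigeonhole both hold at some point.\<close>
      then have "?B 0 \<and> ?C 0 \<or> ?B b \<and> ?C b \<or> ?B (-b) \<and> ?C (-b)"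
        by blast
      then obtain c where "matched_param c \<in> param_space" "?B c" "?C c"
        by (elim disjE conjE) (rule that[OF in_space(3)] that[OF in_space(1)] that[OF in_space(2)]; assumption)+
      then show "\<exists>\<theta>\<in>param_space. 1 / 4 \<le>
          min (\<P>(x in ?D \<theta>. \<bar>beta_of (est x) - beta_of \<theta>\<bar> \<ge> 1 / 16 / ?F))
            (\<P>(x in ?D \<theta>. \<bar>delta_of (est x) - delta_of \<theta>\<bar> \<ge> 1 / 16 / ?F))"
        by (intro bexI[of _ "matched_param c"]) (simp_all only: components min.bounded_iff conj_absorb)
    qed (intro min.coboundedI1 prob_le)
    show "(INF est\<in>estimators n. SUP \<theta>\<in>param_space.
        \<P>(x in ?D \<theta>. \<bar>alpha_of (est x) - alpha_of \<theta>\<bar> \<ge> 1 / 16 / ?F)) \<ge> 1 / 4"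
    proof (rule inf_sup)
      fix est assume est: "est \<in> estimators n"
      note m = measurable_estimator_components[OF est]
      \<comment> \<open>The intercepts at the points 0 and \<open>b\<close> are 1 and
        \<open>1 - b\<close>, again \<open>b\<close> apart.\<close>
      have "1 / 4 \<le> \<P>(x in ?D (matched_param 0). 1 / 16 / ?F \<le> \<bar>alpha_of (est x) - 1\<bar>)
        \<or> 1 / 4 \<le> \<P>(x in ?D (matched_param b). 1 / 16 / ?F \<le> \<bar>alpha_of (est x) - (1 - b)\<bar>)"
      proof (rule tp[OF _ _ m(1)])
        show "2 * (1 / 16 / ?F) \<le> \<bar>1 - (1 - b)\<bar>" unfolding b(4) by simp
      qed (use b in auto)
      then show "\<exists>\<theta>\<in>param_space. 1 / 4 \<le> \<P>(x in ?D \<theta>. \<bar>alpha_of (est x) - alpha_of \<theta>\<bar> \<ge> 1 / 16 / ?F)"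
      proof
        assume "1 / 4 \<le> \<P>(x in ?D (matched_param 0). 1 / 16 / ?F \<le> \<bar>alpha_of (est x) - 1\<bar>)"
        then show ?thesis
          by (intro bexI[OF _ in_space(3)]) (simp only: components diff_zero)
      next
        assume "1 / 4 \<le> \<P>(x in ?D (matched_param b). 1 / 16 / ?F \<le> \<bar>alpha_of (est x) - (1 - b)\<bar>)"
        then show ?thesis
          by (intro bexI[OF _ in_space(1)]) (simp only: components)
      qed
    qed (rule prob_le)
  qed
  show ?thesis
  \<comment> \<open>\<open>N = 0\<close> works because the bounds hold for every nonempty network,
    with the same constants \<open>1 / 16\<close> and \<open>1 / 4\<close>.\<close>
  proof (intro exI[of _ "0 :: nat"] conjI impI)
    show "\<exists>c\<^sub>\<beta>>0. \<exists>c\<^sub>\<delta>>0. \<exists>c\<^sub>0>0. \<forall>n>0. \<forall>A. network n A \<longrightarrow>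
       (INF est\<in>estimators n. SUP \<theta>\<in>param_space.
          min (\<P>(x in data_law n A \<mu> \<sigma> \<theta>.
                 \<bar>beta_of (est x) - beta_of \<theta>\<bar> \<ge> c\<^sub>\<beta> / frobenius n (row_normalized n A)))
              (\<P>(x in data_law n A \<mu> \<sigma> \<theta>.
                 \<bar>delta_of (est x) - delta_of \<theta>\<bar> \<ge> c\<^sub>\<delta> / frobenius n (row_normalized n A))))
       \<ge> c\<^sub>0"
      by (rule exI[of _ "1 / 16"], rule conjI, simp, rule exI[of _ "1 / 16"], rule conjI, simp,
          rule exI[of _ "1 / 4"], rule conjI, simp) (intro allI impI main(1))
    show "\<exists>c\<^sub>\<alpha>>0. \<exists>c\<^sub>\<alpha>'>0. \<forall>n>0. \<forall>A. network n A \<longrightarrow>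
         (INF est\<in>estimators n. SUP \<theta>\<in>param_space.
            \<P>(x in data_law n A \<mu> \<sigma> \<theta>.
               \<bar>alpha_of (est x) - alpha_of \<theta>\<bar> \<ge> c\<^sub>\<alpha> / frobenius n (row_normalized n A)))
         \<ge> c\<^sub>\<alpha>'"
      by (rule exI[of _ "1 / 16"], rule conjI, simp,
          rule exI[of _ "1 / 4"], rule conjI, simp) (intro allI impI main(2))
  qed
qed

end
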